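(* Let $k, m$ be integers with $1\le k\le m-1$, and let $x:\Sigma^m\to\mathbb{R}^{m+1}$ be a complete, properly immersed self-shrinker. Write $\mathbb{S}^{k}_{\sqrt{k}}\times\mathbb{R}^{m-k}=\{(y,w)\in\mathbb{R}^{k+1}\times\mathbb{R}^{m-k} : |y|=\sqrt{k}\}\subset\mathbb{R}^{m+1}$ for the self-shrinker cylinder. If $x(\Sigma)$ is contained in one of the two closed regions determined by this cylinder, i.e. either $x(\Sigma)\subseteq\{(y,w): |y|\le\sqrt{k}\}$ or $x(\Sigma)\subseteq\{(y,w): |y|\ge\sqrt{k}\}$, then $x(\Sigma)=\mathbb{S}^{k}_{\sqrt{k}}\times\mathbb{R}^{m-k}$.
   Context: A self-shrinker (of the mean curvature flow) is an isometrically immersed hypersurface $x:\Sigma^m\to\mathbb{R}^{m+1}$ whose mean curvature vector field $\mathbf{H}=\mathrm{tr}_\Sigma\mathbf{A}$ (the trace, not the average, of the vector-valued second fundamental form $\mathbf{A}$) satisfies $x^{\perp}=-\mathbf{H}$, where $(\cdot)^\perp$ is the orthogonal projection onto the normal bundle of $\Sigma$. Complete means geodesically complete in the induced metric; properly immersed means that $x$ is a proper map. $\mathbb{S}^k_{r}$ denotes the sphere of radius $r$ centered at the origin of $\mathbb{R}^{k+1}$. *)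

theory Defs
  imports "HOL-Analysis.Analysis"
begin

section \<open>Smooth maps between Euclidean spaces\<close>

text \<open>The following two predicates are meant for open \<open>S\<close> only: derivatives are taken in the full
  neighbourhood filter \<open>at u\<close>. Being \<open>C^(n+1)\<close> means being differentiable with all directional
  derivatives of class \<open>C^n\<close>.\<close>

primrec Ck_on :: "nat \<Rightarrow> 'a::euclidean_space set \<Rightarrow> ('a \<Rightarrow> 'b::euclidean_space) \<Rightarrow> bool" where
  "Ck_on 0 S f \<longleftrightarrow> continuous_on S f"
| "Ck_on (Suc n) S f \<longleftrightarrow>
     (\<forall>u\<in>S. f differentiable (at u)) \<and>
     (\<forall>v. Ck_on n S (\<lambda>u. frechet_derivative f (at u) v))"

definition smooth_on :: "'a::euclidean_space set \<Rightarrow> ('a \<Rightarrow> 'b::euclidean_space) \<Rightarrow> bool" where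
  "smooth_on S f \<longleftrightarrow> (\<forall>n. Ck_on n S f)"

section \<open>Smooth manifolds and immersions\<close>

text \<open>The manifold is the whole type \<open>'s\<close>, a Hausdorff second countable space; its smooth structure
  is given by an atlas \<open>\<A>\<close> of charts \<open>(U, \<phi>)\<close> with values in \<open>real ^ 'm\<close>. The values of
  \<open>\<phi>\<close> outside \<open>U\<close> are irrelevant. Connectedness is not required.\<close>

type_synonym ('s, 'm) chart = "'s set \<times> ('s \<Rightarrow> real ^ 'm)"

definition smooth_atlas ::
    "('s::{t2_space, second_countable_topology}, 'm::finite) chart set \<Rightarrow> bool" where
  "smooth_atlas \<A> \<longleftrightarrow>
     (\<forall>(U, \<phi>)\<in>\<A>. open U \<and> open (\<phi> ` U) \<and> homeomorphism U (\<phi> ` U) \<phi> (inv_into U \<phi>)) \<and>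
     (\<Union>(U, \<phi>)\<in>\<A>. U) = UNIV \<and>
     (\<forall>(U, \<phi>)\<in>\<A>. \<forall>(V, \<psi>)\<in>\<A>. smooth_on (\<phi> ` (U \<inter> V)) (\<psi> \<circ> inv_into U \<phi>))"

definition immersion ::
    "('s::{t2_space, second_countable_topology}, 'm::finite) chart set \<Rightarrow>
     ('s \<Rightarrow> 'b::euclidean_space) \<Rightarrow> bool" where
  "immersion \<A> x \<longleftrightarrow>
     (\<forall>(U, \<phi>)\<in>\<A>.
        smooth_on (\<phi> ` U) (x \<circ> inv_into U \<phi>) \<and>
        (\<forall>u\<in>\<phi> ` U. inj (frechet_derivative (x \<circ> inv_into U \<phi>) (at u))))"

section \<open>Local geometry of an immersion\<close>

text \<open>Here \<open>X\<close> is a local parametrization of the immersion, i.e. \<open>X = x \<circ> \<phi>\<^sup>-\<^sup>1\<close> for a chart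
  \<open>\<phi>\<close>, and \<open>u\<close> is a point in the image of the chart.\<close>

definition partial :: "'m \<Rightarrow> (real ^ 'm \<Rightarrow> 'b::real_normed_vector) \<Rightarrow> real ^ 'm::finite \<Rightarrow> 'b" where
  "partial i f u = frechet_derivative f (at u) (axis i 1)"

definition induced_metric ::
    "(real ^ 'm \<Rightarrow> 'b::euclidean_space) \<Rightarrow> real ^ 'm::finite \<Rightarrow> real ^ 'm ^ 'm" where
  "induced_metric X u = (\<chi> i j. partial i X u \<bullet> partial j X u)"

definition tangent_space ::
    "(real ^ 'm \<Rightarrow> 'b::euclidean_space) \<Rightarrow> real ^ 'm::finite \<Rightarrow> 'b set" where
  "tangent_space X u = range (frechet_derivative X (at u))"

definition orth_normal_part :: "'b::euclidean_space set \<Rightarrow> 'b \<Rightarrow> 'b" where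
  "orth_normal_part T v = (THE n. n \<in> orthogonal_comp T \<and> v - n \<in> T)"

lemma orth_normal_part_unique:
  fixes T :: "'b::euclidean_space set"
  assumes "subspace T"
  shows "\<exists>!n. n \<in> orthogonal_comp T \<and> v - n \<in> T"
proof -
  obtain y z where yz: "y \<in> span T" "\<And>w. w \<in> span T \<Longrightarrow> orthogonal z w" "v = y + z"
    using orthogonal_subspace_decomp_exists by blast
  have sp: "span T = T"
    using assms by (simp add: span_eq_iff)
  show ?thesis
  proof (rule ex1I[of _ z])
    show "z \<in> orthogonal_comp T \<and> v - z \<in> T"
      using yz sp by (auto simp: orthogonal_comp_def orthogonal_commute)
  next
    fix n assume n: "n \<in> orthogonal_comp T \<and> v - n \<in> T"
    have "z - n = (v - n) - y"
      using yz by simp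
    then have "z - n \<in> T"
      using n yz sp assms by (metis subspace_diff)
    moreover have "orthogonal w (z - n)" if "w \<in> T" for w
      using that n yz sp
      by (auto simp: orthogonal_comp_def orthogonal_def inner_diff_right inner_commute)
    ultimately have "z - n = 0"
      by (metis orthogonal_self)
    then show "n = z" by simp
  qed
qed

text \<open>The second fundamental form is \<open>A(\<partial>\<^sub>i, \<partial>\<^sub>j) = (\<partial>\<^sub>i\<partial>\<^sub>j X)\<^sup>\<bottom>\<close>; its trace
  with respect to the induced metric \<open>g\<close> is \<open>\<Sum>\<^sub>i\<^sub>j g\<^sup>i\<^sup>j A(\<partial>\<^sub>i, \<partial>\<^sub>j)\<close> (no
  division by the dimension).\<close>

definition second_fundamental_form ::
    "(real ^ 'm \<Rightarrow> 'b::euclidean_space) \<Rightarrow> real ^ 'm::finite \<Rightarrow> 'm \<Rightarrow> 'm \<Rightarrow> 'b" where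
  "second_fundamental_form X u i j =
     orth_normal_part (tangent_space X u) (partial i (partial j X) u)"

definition mean_curvature_vector ::
    "(real ^ 'm \<Rightarrow> 'b::euclidean_space) \<Rightarrow> real ^ 'm::finite \<Rightarrow> 'b" where
  "mean_curvature_vector X u =
     (\<Sum>i\<in>UNIV. \<Sum>j\<in>UNIV.
        matrix_inv (induced_metric X u) $ i $ j *\<^sub>R second_fundamental_form X u i j)"

text \<open>\<open>christoffel X u k i j\<close> is the Christoffel symbol \<open>\<Gamma>\<^sup>k\<^sub>i\<^sub>j\<close> of the
  Levi-Civita connection of the induced metric.\<close>

definition christoffel ::
    "(real ^ 'm \<Rightarrow> 'b::euclidean_space) \<Rightarrow> real ^ 'm::finite \<Rightarrow> 'm \<Rightarrow> 'm \<Rightarrow> 'm \<Rightarrow> real" where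
  "christoffel X u k i j =
     (\<Sum>l\<in>UNIV. matrix_inv (induced_metric X u) $ k $ l *
        (partial i (\<lambda>u. induced_metric X u $ j $ l) u
         + partial j (\<lambda>u. induced_metric X u $ i $ l) u
         - partial l (\<lambda>u. induced_metric X u $ i $ j) u)) / 2"

section \<open>Self-shrinkers, completeness, properness\<close>

definition self_shrinker ::
    "('s::{t2_space, second_countable_topology}, 'm::finite) chart set \<Rightarrow>
     ('s \<Rightarrow> 'b::euclidean_space) \<Rightarrow> bool" where
  "self_shrinker \<A> x \<longleftrightarrow>
     DIM('b) = CARD('m) + 1 \<and> smooth_atlas \<A> \<and> immersion \<A> x \<and>
     (\<forall>(U, \<phi>)\<in>\<A>. \<forall>p\<in>U.
        orth_normal_part (tangent_space (x \<circ> inv_into U \<phi>) (\<phi> p)) (x p)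
          = - mean_curvature_vector (x \<circ> inv_into U \<phi>) (\<phi> p))"

text \<open>A curve defined on all of \<open>\<real>\<close> is a geodesic if in every chart its coordinate expression
  \<open>c = \<phi> \<circ> \<gamma>\<close>, with velocity \<open>c'\<close>, satisfies
  \<open>c''\<^sup>k = - \<Sum>\<^sub>i\<^sub>j \<Gamma>\<^sup>k\<^sub>i\<^sub>j(c) c'\<^sup>i c'\<^sup>j\<close> at
  all times at which the curve is in the chart domain.\<close>

definition complete_geodesic ::
    "('s::{t2_space, second_countable_topology}, 'm::finite) chart set \<Rightarrow>
     ('s \<Rightarrow> 'b::euclidean_space) \<Rightarrow> (real \<Rightarrow> 's) \<Rightarrow> bool" where
  "complete_geodesic \<A> x \<gamma> \<longleftrightarrow>
     continuous_on UNIV \<gamma> \<and>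
     (\<forall>(U, \<phi>)\<in>\<A>. \<exists>c'. \<forall>t. \<gamma> t \<in> U \<longrightarrow>
        ((\<phi> \<circ> \<gamma>) has_vector_derivative c' t) (at t) \<and>
        (c' has_vector_derivative
           (\<chi> k. - (\<Sum>i\<in>UNIV. \<Sum>j\<in>UNIV.
              christoffel (x \<circ> inv_into U \<phi>) (\<phi> (\<gamma> t)) k i j * c' t $ i * c' t $ j))) (at t))"

definition geodesically_complete ::
    "('s::{t2_space, second_countable_topology}, 'm::finite) chart set \<Rightarrow>
     ('s \<Rightarrow> 'b::euclidean_space) \<Rightarrow> bool" where
  "geodesically_complete \<A> x \<longleftrightarrow>
     (\<forall>(U, \<phi>)\<in>\<A>. \<forall>p\<in>U. \<forall>v. \<exists>\<gamma>.
        complete_geodesic \<A> x \<gamma> \<and> \<gamma> 0 = p \<and> ((\<phi> \<circ> \<gamma>) has_vector_derivative v) (at 0))"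

end

theory Submission
  imports Defs
begin

text \<open>Let \<open>L = \<Delta> - \<langle>x, \<nabla>\<rangle>\<close> be the drift Laplacian of the shrinker. The equation \<open>x\<^sup>\<bottom> = -H\<close> gives
  \<open>L (G \<circ> x) = tr\<^sub>T D\<^sup>2G - DG(x)\<close> for every ambient function \<open>G\<close>, where \<open>T\<close> is the tangent space. Hence
  \<open>v = k - |y|\<^sup>2\<close> (inside the cylinder) and \<open>v = ln |y|\<^sup>2 - ln k\<close> (outside) are nonnegative with
  \<open>L v \<le> 0\<close>, and \<open>L v < 0\<close> where \<open>v > 0\<close>. By Hopf's strong minimum principle the set \<open>{v = 0}\<close> is open,
  so \<open>{v > 0}\<close> is open and closed. On this set \<open>v\<close> would attain a positive minimum, because
  \<open>|x|\<^sup>2\<close> is proper with \<open>L |x|\<^sup>2 = 2m - 2|x|\<^sup>2\<close>; this contradicts \<open>L v < 0\<close>. So the image lies in the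
  cylinder; it is closed, contains every point of the cylinder at distance less than \<open>2\<surd>k\<close> from it, and
  the cylinder is connected.\<close>

section \<open>Ambient test functions\<close>

text \<open>The drift Laplacian on the manifold is never constructed: it is evaluated only at local
  minima of functions \<open>G \<circ> x\<close>. There the gradient of \<open>G\<close> is normal
  to the hypersurface, so second derivatives along straight coordinate lines suffice; all tangential
  corrections, Christoffel symbols included, pair to zero with that gradient. The logarithm outside
  the cylinder is forced. If n is the y-part of the unit normal, L |y|^2 = 2(k + 1 - |n|^2) -
  2|y|^2, which may be positive for k < |y|^2 < k + 1, so |y|^2 - k fails as a supersolution; the
  concavity of ln absorbs the excess. Inside, the same excess has the favourable sign. Once {v > 0}
  is open and closed, minimizing over this set alone still gives local minima on the whole
  manifold.\<close>

definition orthonormal :: "'b::euclidean_space set \<Rightarrow> bool" where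
  "orthonormal B \<longleftrightarrow> pairwise orthogonal B \<and> (\<forall>e\<in>B. norm e = 1)"

lemma orthonormal_finite: "orthonormal B \<Longrightarrow> finite B"
  by (simp add: orthonormal_def pairwise_orthogonal_imp_finite)

lemma orthonormal_inner:
  assumes "orthonormal B" "e \<in> B" "f \<in> B"
  shows "e \<bullet> f = (if e = f then 1 else 0)"
  using assms by (auto simp: orthonormal_def pairwise_def orthogonal_def norm_eq_1)

lemma orthonormal_independent: "orthonormal B \<Longrightarrow> independent B"
  unfolding orthonormal_def by (intro pairwise_orthogonal_independent) auto

lemma orthonormal_expansion:
  assumes B: "orthonormal B" and z: "z \<in> span B"
  shows "z = (\<Sum>e\<in>B. (z \<bullet> e) *\<^sub>R e)"
proof -
  define d where "d = z - (\<Sum>e\<in>B. (z \<bullet> e) *\<^sub>R e)"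
  have fin: "finite B" using B by (rule orthonormal_finite)
  have "d \<bullet> f = 0" if "f \<in> B" for f
  proof -
    have "(\<Sum>e\<in>B. (z \<bullet> e) *\<^sub>R e) \<bullet> f = (\<Sum>e\<in>B. if e = f then z \<bullet> e else 0)"
      unfolding inner_sum_left
      by (intro sum.cong refl) (use that in \<open>auto simp: orthonormal_inner[OF B]\<close>)
    also have "\<dots> = z \<bullet> f" using fin that by simp
    finally show ?thesis by (simp add: d_def inner_diff_left)
  qed
  then have "orthogonal d w" if "w \<in> span B" for w
    using that orthogonal_to_span[of w B d] by (simp add: orthogonal_def)
  moreover have "d \<in> span B"
    unfolding d_def by (intro span_diff z span_sum span_scale span_base)
  ultimately have "d = 0" by (metis orthogonal_self)
  then show ?thesis by (simp add: d_def)
qed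

lemma orthonormal_parseval:
  assumes B: "orthonormal B" and z: "z \<in> span B"
  shows "y \<bullet> z = (\<Sum>e\<in>B. (y \<bullet> e) * (z \<bullet> e))"
  by (subst orthonormal_expansion[OF B z]) (simp add: inner_sum_right mult.commute)

text \<open>Codimension one enters here: one unit normal completes \<open>B\<close> to a basis, so a
  trace over \<open>B\<close> is an ambient trace minus a single term in \<open>N\<close>.\<close>

lemma orthonormal_hyperplane_normal:
  fixes B :: "'b::euclidean_space set"
  assumes B: "orthonormal B" and card: "card B + 1 = DIM('b)"
  obtains N where "norm N = 1" "\<And>e. e \<in> B \<Longrightarrow> e \<bullet> N = 0"
    "\<And>y z. y \<bullet> z = (\<Sum>e\<in>B. (y \<bullet> e) * (z \<bullet> e)) + (y \<bullet> N) * (z \<bullet> N)"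
proof -
  have fin: "finite B" using B by (rule orthonormal_finite)
  have "dim B < DIM('b)"
    using card dim_le_card'[OF fin] by linarith
  then obtain n where n: "n \<noteq> 0" "\<And>y. y \<in> span B \<Longrightarrow> orthogonal n y"
    using orthogonal_to_subspace_exists by blast
  define N where "N = n /\<^sub>R norm n"
  have N: "norm N = 1" "\<And>e. e \<in> B \<Longrightarrow> e \<bullet> N = 0"
    using n by (auto simp: N_def orthogonal_def inner_commute span_base)
  have "N \<notin> B" using N by (metis inner_eq_zero_iff norm_zero zero_neq_one)
  have B': "orthonormal (insert N B)"
    using B N by (auto simp: orthonormal_def pairwise_insert orthogonal_def inner_commute)
  have "card (insert N B) = DIM('b)"
    using \<open>N \<notin> B\<close> fin card by simp
  then have "span (insert N B) = UNIV"
    using card_ge_dim_independent[of "insert N B" UNIV] orthonormal_independent[OF B'] by auto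
  then have "y \<bullet> z = (\<Sum>e\<in>insert N B. (y \<bullet> e) * (z \<bullet> e))" for y z
    using orthonormal_parseval[OF B', of z y] by simp
  moreover have "(\<Sum>e\<in>insert N B. (y \<bullet> e) * (z \<bullet> e))
      = (\<Sum>e\<in>B. (y \<bullet> e) * (z \<bullet> e)) + (y \<bullet> N) * (z \<bullet> N)" for y z
    using \<open>N \<notin> B\<close> fin by simp
  ultimately show ?thesis
    using that[of N] N by metis
qed

text \<open>\<open>g\<close> is the gradient near \<open>z\<close> and \<open>H\<close> the Hessian
  at \<open>z\<close> as a linear map. The gradient is required on a neighbourhood so that it can be
  differentiated once more along curves through \<open>z\<close>.\<close>

definition twice_diff_at ::
    "('b::euclidean_space \<Rightarrow> real) \<Rightarrow> ('b \<Rightarrow> 'b) \<Rightarrow> ('b \<Rightarrow> 'b) \<Rightarrow> 'b \<Rightarrow> bool" where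
  "twice_diff_at G g H z \<longleftrightarrow>
     (\<forall>\<^sub>F y in nhds z. (G has_derivative (\<lambda>h. g y \<bullet> h)) (at y)) \<and> (g has_derivative H) (at z)"

lemma twice_diff_at_linear_combination:
  assumes "twice_diff_at G g H z" "twice_diff_at G' g' H' z"
  shows "twice_diff_at (\<lambda>y. G y + c * G' y) (\<lambda>y. g y + c *\<^sub>R g' y) (\<lambda>h. H h + c *\<^sub>R H' h) z"
proof -
  have "\<forall>\<^sub>F y in nhds z. ((\<lambda>y. G y + c * G' y) has_derivative (\<lambda>h. (g y + c *\<^sub>R g' y) \<bullet> h)) (at y)"
    using assms[unfolded twice_diff_at_def, THEN conjunct1]
  proof eventually_elim
    case (elim y)
    then show ?case
      by (auto intro!: derivative_eq_intros simp: inner_add_left)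
  qed
  then show ?thesis
    using assms by (auto simp: twice_diff_at_def intro!: derivative_eq_intros)
qed

text \<open>The open set \<open>S\<close> admits outer functions such as \<open>ln\<close> that are
  differentiable on part of the line only. The rank-one term in the Hessian is what the barriers
  exploit.\<close>

lemma twice_diff_at_compose:
  assumes G: "twice_diff_at G g H z"
    and \<psi>: "\<And>t. t \<in> S \<Longrightarrow> (\<psi> has_real_derivative \<psi>' t) (at t)"
    and \<psi>': "(\<psi>' has_real_derivative \<psi>'') (at (G z))"
    and S: "open S" "G z \<in> S"
  shows "twice_diff_at (\<lambda>y. \<psi> (G y)) (\<lambda>y. \<psi>' (G y) *\<^sub>R g y)
           (\<lambda>h. \<psi>' (G z) *\<^sub>R H h + (\<psi>'' * (g z \<bullet> h)) *\<^sub>R g z) z"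
proof -
  have ev: "\<forall>\<^sub>F y in nhds z. (G has_derivative (\<lambda>h. g y \<bullet> h)) (at y)"
    and gH: "(g has_derivative H) (at z)"
    using G by (auto simp: twice_diff_at_def)
  have Gz: "(G has_derivative (\<lambda>h. g z \<bullet> h)) (at z)"
    using eventually_nhds_x_imp_x[OF ev] .
  then have "isCont G z"
    using has_derivative_continuous by blast
  then have evS: "\<forall>\<^sub>F y in nhds z. G y \<in> S"
    using topological_tendstoD[of G "G z" "nhds z" S] S
    by (simp add: isCont_def tendsto_at_iff_tendsto_nhds)
  have "\<forall>\<^sub>F y in nhds z. ((\<lambda>y. \<psi> (G y)) has_derivative (\<lambda>h. (\<psi>' (G y) *\<^sub>R g y) \<bullet> h)) (at y)"
    using ev evS
  proof eventually_elim
    case (elim y)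
    have "((\<lambda>y. \<psi> (G y)) has_derivative (\<lambda>h. \<psi>' (G y) * (g y \<bullet> h))) (at y)"
      using has_derivative_compose[OF elim(1), of \<psi> "(*) (\<psi>' (G y))"] \<psi>[OF elim(2)]
      by (simp add: has_field_derivative_def)
    then show ?case by simp
  qed
  moreover have "((\<lambda>y. \<psi>' (G y)) has_derivative (\<lambda>h. \<psi>'' * (g z \<bullet> h))) (at z)"
    using has_derivative_compose[OF Gz, of \<psi>' "(*) \<psi>''"] \<psi>'
    by (simp add: has_field_derivative_def)
  then have "((\<lambda>y. \<psi>' (G y) *\<^sub>R g y) has_derivative
        (\<lambda>h. \<psi>' (G z) *\<^sub>R H h + (\<psi>'' * (g z \<bullet> h)) *\<^sub>R g z)) (at z)"
    using gH by (auto intro!: derivative_eq_intros)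
  ultimately show ?thesis by (simp add: twice_diff_at_def)
qed

lemma twice_diff_at_dist_square:
  "twice_diff_at (\<lambda>y. (y - c) \<bullet> (y - c)) (\<lambda>y. 2 *\<^sub>R (y - c)) (\<lambda>h. 2 *\<^sub>R h) z"
proof -
  have "((\<lambda>y. (y - c) \<bullet> (y - c)) has_derivative (\<lambda>h. (2 *\<^sub>R (y - c)) \<bullet> h)) (at y)" for y
    by (rule has_derivative_eq_rhs, (rule derivative_intros)+)
      (simp add: fun_eq_iff inner_commute inner_diff_left inner_diff_right)
  moreover have "((\<lambda>y. 2 *\<^sub>R (y - c)) has_derivative (\<lambda>h. 2 *\<^sub>R h)) (at z)"
    by (auto intro!: derivative_eq_intros)
  ultimately show ?thesis by (simp add: twice_diff_at_def)
qed

lemma twice_diff_at_fst_square: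
  fixes z :: "'p::euclidean_space \<times> 'q::euclidean_space"
  shows "twice_diff_at (\<lambda>y. fst y \<bullet> fst y) (\<lambda>y. (2 *\<^sub>R fst y, 0)) (\<lambda>h. (2 *\<^sub>R fst h, 0)) z"
proof -
  have "((\<lambda>y. fst y \<bullet> fst y) has_derivative (\<lambda>h. (2 *\<^sub>R fst y, 0) \<bullet> h)) (at y)"
    for y :: "'p \<times> 'q"
    by (rule has_derivative_eq_rhs, (rule derivative_intros)+)
      (simp add: fun_eq_iff inner_commute inner_prod_def)
  moreover have "((\<lambda>y::'p \<times> 'q. (2 *\<^sub>R fst y, 0::'q)) has_derivative (\<lambda>h. (2 *\<^sub>R fst h, 0))) (at z)"
    by (auto intro!: derivative_eq_intros)
  ultimately show ?thesis by (simp add: twice_diff_at_def)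
qed

text \<open>For the tangent space at a point of a self-shrinker, \<open>shrinker_op\<close> is the drift Laplacian
  \<open>\<Delta> - \<langle>x, \<nabla>\<rangle>\<close> of the restriction of an ambient function with gradient \<open>g\<close> and
  Hessian \<open>H\<close>.\<close>

definition shrinker_op :: "'b::euclidean_space set \<Rightarrow> 'b \<Rightarrow> ('b \<Rightarrow> 'b) \<Rightarrow> 'b \<Rightarrow> real" where
  "shrinker_op B g H z = (\<Sum>e\<in>B. H e \<bullet> e) - g \<bullet> z"

lemma shrinker_op_linear_combination:
  "shrinker_op B (g + c *\<^sub>R g') (\<lambda>h. H h + c *\<^sub>R H' h) z = shrinker_op B g H z + c * shrinker_op B g' H' z"
  by (simp add: shrinker_op_def inner_add_left sum.distrib sum_distrib_left algebra_simps)

lemma shrinker_op_compose: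
  "shrinker_op B (a *\<^sub>R g) (\<lambda>h. a *\<^sub>R H h + (b * (g \<bullet> h)) *\<^sub>R g) z
     = a * shrinker_op B g H z + b * (\<Sum>e\<in>B. (g \<bullet> e)\<^sup>2)"
  by (simp add: shrinker_op_def inner_add_left sum.distrib sum_distrib_left algebra_simps power2_eq_square)

lemma shrinker_op_dist_square:
  assumes "orthonormal B"
  shows "shrinker_op B (2 *\<^sub>R (z - c)) (\<lambda>h. 2 *\<^sub>R h) z = 2 * real (card B) - 2 * ((z - c) \<bullet> z)"
  using assms by (simp add: shrinker_op_def orthonormal_inner)

text \<open>Here \<open>n\<close> is the first component of the unit normal \<open>N\<close>.
  Parseval for the vector \<open>(y, 0)\<close> gives the last identity; summing it over the
  coordinate vectors \<open>y\<close> gives the trace.\<close>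

lemma sum_fst_square_orthonormal_hyperplane:
  fixes B :: "((real ^ 'p::finite) \<times> (real ^ 'q::finite)) set"
  assumes B: "orthonormal B" and card: "card B + 1 = CARD('p) + CARD('q)"
  obtains n where "norm n \<le> 1" "(\<Sum>e\<in>B. fst e \<bullet> fst e) = CARD('p) - n \<bullet> n"
    "\<And>y. (\<Sum>e\<in>B. (y \<bullet> fst e)\<^sup>2) = y \<bullet> y - (y \<bullet> n)\<^sup>2"
proof -
  have "card B + 1 = DIM((real ^ 'p) \<times> (real ^ 'q))" using card by simp
  then obtain N where N: "norm N = 1" "\<And>e. e \<in> B \<Longrightarrow> e \<bullet> N = 0"
      "\<And>y z. y \<bullet> z = (\<Sum>e\<in>B. (y \<bullet> e) * (z \<bullet> e)) + (y \<bullet> N) * (z \<bullet> N)"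
    using orthonormal_hyperplane_normal[OF B] by blast
  have sq: "(\<Sum>e\<in>B. (y \<bullet> fst e)\<^sup>2) = y \<bullet> y - (y \<bullet> fst N)\<^sup>2" for y
    using N(3)[of "(y, 0)" "(y, 0)"] by (simp add: inner_prod_def power2_eq_square)
  have nn: "n \<bullet> n = (\<Sum>i\<in>UNIV. (axis i 1 \<bullet> n)\<^sup>2)" for n :: "real ^ 'p"
    unfolding inner_axis' by (simp add: inner_vec_def power2_eq_square)
  have "(\<Sum>e\<in>B. fst e \<bullet> fst e) = (\<Sum>i\<in>UNIV. \<Sum>e\<in>B. (axis i 1 \<bullet> fst e)\<^sup>2)"
    unfolding nn by (rule sum.swap)
  also have "\<dots> = CARD('p) - fst N \<bullet> fst N"
    unfolding sq by (simp add: sum_subtractf nn[of "fst N"] inner_axis_axis)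
  finally have "(\<Sum>e\<in>B. fst e \<bullet> fst e) = CARD('p) - fst N \<bullet> fst N" .
  moreover have "norm (fst N) \<le> 1"
    using N(1) norm_fst_le[of "fst N" "snd N"] by simp
  ultimately show ?thesis using that sq by blast
qed

section \<open>The minimum principle for ambient functions\<close>

lemma linear_sum_axis:
  fixes F :: "real ^ 'm::finite \<Rightarrow> 'b::real_vector"
  assumes "linear F"
  shows "F v = (\<Sum>j\<in>UNIV. (v $ j) *\<^sub>R F (axis j 1))"
proof -
  have "F v = F (\<Sum>j\<in>UNIV. (v $ j) *\<^sub>R axis j 1)"
    using basis_expansion[of v] by (simp add: scalar_mult_eq_scaleR)
  then show ?thesis by (simp add: linear_sum[OF assms] linear_scale[OF assms])
qed

text \<open>\<open>f'\<close> is differentiable at 0 only. If \<open>s\<close> were negative,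
  \<open>f'\<close> would be negative just to the right of 0, and the mean value theorem would push
  \<open>f\<close> below \<open>f 0\<close>.\<close>

lemma second_derivative_test:
  fixes f f' :: "real \<Rightarrow> real"
  assumes f: "\<forall>\<^sub>F t in nhds 0. (f has_real_derivative f' t) (at t)"
    and f': "(f' has_real_derivative s) (at 0)"
    and min: "\<forall>\<^sub>F t in nhds 0. f 0 \<le> f t"
  shows "f' 0 = 0" and "s \<ge> 0"
proof -
  obtain d where d: "d > 0" "\<And>t. \<bar>t\<bar> < d \<Longrightarrow> (f has_real_derivative f' t) (at t)" "\<And>t. \<bar>t\<bar> < d \<Longrightarrow> f 0 \<le> f t"
    using eventually_conj[OF f min] unfolding eventually_nhds_metric by (auto simp: dist_real_def)
  show zero: "f' 0 = 0"
    using DERIV_local_min[of f "f' 0" 0 d] d by simp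
  show "s \<ge> 0"
  proof (rule ccontr)
    assume "\<not> s \<ge> 0"
    then obtain e where e: "e > 0" "\<And>h. 0 < h \<Longrightarrow> h < e \<Longrightarrow> f' h < 0"
      using DERIV_neg_dec_right[OF f'] zero by auto
    define t where "t = min d e / 2"
    have t: "0 < t" "t < d" "t < e" using d e by (auto simp: t_def)
    obtain z where z: "0 < z" "z < t" "f t - f 0 = (t - 0) * f' z"
      using MVT2[of 0 t f f'] t d(2) by auto
    have "f t - f 0 < 0"
      using z t e(2)[of z] by (simp add: mult_pos_neg)
    then show False using d(3)[of t] t by simp
  qed
qed

section \<open>Derivatives of a parametrization and the metric trace\<close>

lemma orth_normal_part_props:
  assumes "subspace T"
  shows "orth_normal_part T v \<in> orthogonal_comp T" "v - orth_normal_part T v \<in> T"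
  using theI'[OF orth_normal_part_unique[OF assms, of v]] by (simp_all add: orth_normal_part_def)

lemma smooth_on_has_derivative:
  assumes "smooth_on V X" "u \<in> V"
  shows "(X has_derivative frechet_derivative X (at u)) (at u)"
proof -
  have "Ck_on (Suc 0) V X" using assms(1) by (simp add: smooth_on_def del: Ck_on.simps)
  then show ?thesis using assms(2) by (simp add: frechet_derivative_works)
qed

lemma smooth_on_partial:
  assumes "smooth_on V X"
  shows "smooth_on V (partial i X)"
  unfolding smooth_on_def
proof
  fix n
  have "Ck_on (Suc n) V X" using assms by (simp add: smooth_on_def del: Ck_on.simps)
  moreover have "partial i X = (\<lambda>u. frechet_derivative X (at u) (axis i 1))"
    by (simp add: fun_eq_iff partial_def)
  ultimately show "Ck_on n V (partial i X)" by simp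
qed

lemma frechet_derivative_partial:
  assumes "smooth_on V X" "u \<in> V"
  shows "frechet_derivative X (at u) v = (\<Sum>j\<in>UNIV. (v $ j) *\<^sub>R partial j X u)"
  using linear_sum_axis[of "frechet_derivative X (at u)" v]
    smooth_on_has_derivative[OF assms, THEN has_derivative_linear]
  by (simp add: partial_def)

text \<open>The columns of \<open>W\<close> form a frame orthonormal for \<open>g\<close>, so the
  inverse metric is the sum of the outer squares of the frame vectors.\<close>

lemma matrix_inv_eq_of_congruence:
  fixes g W :: "real ^ 'm::finite ^ 'm"
  assumes "transpose W ** g ** W = mat 1"
  shows "matrix_inv g = W ** transpose W"
proof -
  have "W ** (transpose W ** g) = mat 1"
    using assms matrix_left_right_inverse by metis
  then have l: "(W ** transpose W) ** g = mat 1" by (simp add: matrix_mul_assoc)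
  then have r: "g ** (W ** transpose W) = mat 1"
    using matrix_left_right_inverse by metis
  have "invertible g" unfolding invertible_def using l r by blast
  then have "matrix_inv g ** g = mat 1"
    unfolding matrix_inv_def invertible_def by (metis (mono_tags, lifting) someI_ex)
  then have "matrix_inv g = matrix_inv g ** g ** (W ** transpose W)"
    by (metis matrix_mul_assoc matrix_mul_rid r)
  then show ?thesis using \<open>matrix_inv g ** g = mat 1\<close> by (simp add: matrix_mul_lid)
qed

text \<open>In the frame \<open>w\<close>, orthonormal for the induced metric, the inverse metric is
  \<open>\<Sum>\<^sub>i w\<^sub>i w\<^sub>i\<^sup>T\<close>, so the metric trace becomes a sum of second derivatives along the
  lines in direction \<open>w\<^sub>i\<close>.\<close>

lemma metric_trace_orthonormal_frame:
  fixes X :: "real ^ 'm::finite \<Rightarrow> 'b::euclidean_space" and w :: "'m \<Rightarrow> real ^ 'm"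
    and S :: "'m \<Rightarrow> 'm \<Rightarrow> 'b"
  assumes X: "smooth_on V X" "u \<in> V"
    and w: "\<And>i j. frechet_derivative X (at u) (w i) \<bullet> frechet_derivative X (at u) (w j) = (if i = j then 1 else 0)"
  shows "(\<Sum>i\<in>UNIV. \<Sum>j\<in>UNIV. matrix_inv (induced_metric X u) $ i $ j *\<^sub>R S i j)
      = (\<Sum>k\<in>UNIV. \<Sum>i\<in>UNIV. \<Sum>j\<in>UNIV. (w k $ i * w k $ j) *\<^sub>R S i j)"
proof -
  define W where "W = (\<chi> i k. w k $ i)"
  have "(transpose W ** induced_metric X u ** W) $ a $ b = (if a = b then 1 else 0)" for a b
  proof -
    have "(transpose W ** induced_metric X u ** W) $ a $ b
        = (\<Sum>j\<in>UNIV. (\<Sum>i\<in>UNIV. w a $ i * (partial i X u \<bullet> partial j X u)) * w b $ j)"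
      by (simp add: matrix_matrix_mult_def transpose_def W_def induced_metric_def)
    also have "\<dots> = (\<Sum>j\<in>UNIV. \<Sum>i\<in>UNIV. w a $ i * (w b $ j * (partial i X u \<bullet> partial j X u)))"
      by (simp add: sum_distrib_right mult.assoc mult.commute[of "partial _ X u \<bullet> partial _ X u"])
    also have "\<dots> = (\<Sum>i\<in>UNIV. \<Sum>j\<in>UNIV. w a $ i * (w b $ j * (partial i X u \<bullet> partial j X u)))"
      by (rule sum.swap)
    also have "\<dots> = (\<Sum>i\<in>UNIV. (w a $ i) *\<^sub>R partial i X u) \<bullet> (\<Sum>j\<in>UNIV. (w b $ j) *\<^sub>R partial j X u)"
      by (simp add: inner_sum_left) (simp add: inner_sum_right sum_distrib_left)
    also have "\<dots> = (if a = b then 1 else 0)"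
      using w[of a b] by (simp add: frechet_derivative_partial[OF X])
    finally show ?thesis .
  qed
  then have "transpose W ** induced_metric X u ** W = mat 1"
    by (simp add: vec_eq_iff mat_def)
  then have inv: "matrix_inv (induced_metric X u) $ i $ j = (\<Sum>k\<in>UNIV. w k $ i * w k $ j)" for i j
    by (simp add: matrix_inv_eq_of_congruence) (simp add: matrix_matrix_mult_def transpose_def W_def)
  have "(\<Sum>i\<in>UNIV. \<Sum>j\<in>UNIV. matrix_inv (induced_metric X u) $ i $ j *\<^sub>R S i j)
      = (\<Sum>i\<in>UNIV. \<Sum>j\<in>UNIV. \<Sum>k\<in>UNIV. (w k $ i * w k $ j) *\<^sub>R S i j)"
    by (simp add: inv scaleR_sum_left)
  also have "\<dots> = (\<Sum>i\<in>UNIV. \<Sum>k\<in>UNIV. \<Sum>j\<in>UNIV. (w k $ i * w k $ j) *\<^sub>R S i j)"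
    by (rule sum.cong[OF refl], rule sum.swap)
  also have "\<dots> = (\<Sum>k\<in>UNIV. \<Sum>i\<in>UNIV. \<Sum>j\<in>UNIV. (w k $ i * w k $ j) *\<^sub>R S i j)"
    by (rule sum.swap)
  finally show ?thesis .
qed

text \<open>Since \<open>(tr A + x)\<^sup>\<bottom> = 0\<close>, the metric trace of the coordinate Hessian of the immersion and the
  position vector add up to a tangent vector.\<close>

lemma self_shrinker_trace_tangent:
  fixes X :: "real ^ 'm::finite \<Rightarrow> 'b::euclidean_space"
  assumes T: "subspace (tangent_space X u)"
    and shr: "orth_normal_part (tangent_space X u) (X u) = - mean_curvature_vector X u"
  shows "(\<Sum>i\<in>UNIV. \<Sum>j\<in>UNIV. matrix_inv (induced_metric X u) $ i $ j *\<^sub>R partial i (partial j X) u) + X u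
           \<in> tangent_space X u"
proof -
  let ?T = "tangent_space X u" and ?g = "matrix_inv (induced_metric X u)"
  have "(\<Sum>i\<in>UNIV. \<Sum>j\<in>UNIV. ?g $ i $ j *\<^sub>R (partial i (partial j X) u - second_fundamental_form X u i j)) \<in> ?T"
    unfolding second_fundamental_form_def
    by (intro subspace_sum[OF T] subspace_scale[OF T] orth_normal_part_props(2)[OF T])
  then have "(\<Sum>i\<in>UNIV. \<Sum>j\<in>UNIV. ?g $ i $ j *\<^sub>R partial i (partial j X) u) - mean_curvature_vector X u \<in> ?T"
    by (simp add: mean_curvature_vector_def scaleR_diff_right sum_subtractf)
  from subspace_add[OF T this orth_normal_part_props(2)[OF T, of "X u"]]
  show ?thesis by (simp add: shr)
qed

text \<open>The curve is the image of a straight coordinate line, not a geodesic, so its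
  acceleration has a tangential part. By the first claim \<open>g (X u)\<close> annihilates that
  part at a minimum.\<close>

lemma second_derivative_along_line:
  fixes X :: "real ^ 'm::finite \<Rightarrow> 'b::euclidean_space"
  assumes V: "open V" "smooth_on V X" "u \<in> V"
    and G: "twice_diff_at G g H (X u)"
    and min: "\<forall>\<^sub>F a in nhds u. G (X u) \<le> G (X a)"
  defines "A \<equiv> frechet_derivative X (at u)"
  shows "g (X u) \<bullet> A w = 0"
    and "H (A w) \<bullet> A w + g (X u) \<bullet> (\<Sum>i\<in>UNIV. \<Sum>j\<in>UNIV. (w $ i * w $ j) *\<^sub>R partial i (partial j X) u) \<ge> 0"
proof -
  define c where "c = (\<lambda>t. u + t *\<^sub>R w)"
  \<comment> \<open>Writing the derivative through the partials of \<open>X\<close> makes it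
    differentiable again by \<open>smooth_on_partial\<close>.\<close>
  define f' where "f' = (\<lambda>t. g (X (c t)) \<bullet> (\<Sum>j\<in>UNIV. (w $ j) *\<^sub>R partial j X (c t)))"
  have c: "(c has_derivative (\<lambda>h. h *\<^sub>R w)) (at t)" for t
    unfolding c_def by (auto intro!: derivative_eq_intros)
  have c0 [simp]: "c 0 = u" by (simp add: c_def)
  have lim: "filterlim c (nhds u) (nhds 0)"
    using tendsto_at_iff_tendsto_nhds[of c 0] has_derivative_continuous[OF c, of 0]
    by (simp add: isCont_def)
  have limX: "filterlim X (nhds (X u)) (nhds u)"
    using has_derivative_continuous[OF smooth_on_has_derivative[OF V(2,3)]]
    by (simp add: isCont_def tendsto_at_iff_tendsto_nhds)
  have evV: "\<forall>\<^sub>F t in nhds 0. c t \<in> V"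
    using V(1,3) lim topological_tendstoD by blast
  have evG: "\<forall>\<^sub>F t in nhds 0. (G has_derivative (\<lambda>h. g (X (c t)) \<bullet> h)) (at (X (c t)))"
    using filterlim_iff[THEN iffD1, OF filterlim_compose[OF limX lim]] G
    by (auto simp: twice_diff_at_def)
  have 1: "\<forall>\<^sub>F t in nhds 0. ((\<lambda>t. G (X (c t))) has_real_derivative f' t) (at t)"
    using evV evG
  proof eventually_elim
    case (elim t)
    have "((\<lambda>t. X (c t)) has_derivative (\<lambda>h. frechet_derivative X (at (c t)) (h *\<^sub>R w))) (at t)"
      using has_derivative_compose[OF c smooth_on_has_derivative[OF V(2) elim(1)]] .
    from has_derivative_compose[OF this elim(2)]
    have "((\<lambda>t. G (X (c t))) has_derivative (\<lambda>h. g (X (c t)) \<bullet> frechet_derivative X (at (c t)) (h *\<^sub>R w))) (at t)" .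
    then show ?case
      unfolding has_field_derivative_def
      by (rule has_derivative_eq_rhs)
        (simp add: fun_eq_iff f'_def frechet_derivative_partial[OF V(2) elim(1)] inner_sum_right sum_distrib_left mult_ac)
  qed
  have Xc: "((\<lambda>t. X (c t)) has_derivative (\<lambda>h. A (h *\<^sub>R w))) (at 0)"
    using has_derivative_compose[OF c, of X A 0] smooth_on_has_derivative[OF V(2,3)] by (simp add: A_def)
  have gX: "((\<lambda>t. g (X (c t))) has_derivative (\<lambda>h. H (A (h *\<^sub>R w)))) (at 0)"
    using has_derivative_compose[OF Xc, of g H] G by (simp add: twice_diff_at_def)
  have pX: "((\<lambda>t. partial j X (c t)) has_derivative
      (\<lambda>h. \<Sum>i\<in>UNIV. ((h *\<^sub>R w) $ i) *\<^sub>R partial i (partial j X) u)) (at 0)" for j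
    using has_derivative_compose[OF c, of "partial j X" "frechet_derivative (partial j X) (at u)" 0]
      smooth_on_has_derivative[OF smooth_on_partial[OF V(2)] V(3), of j]
    unfolding frechet_derivative_partial[OF smooth_on_partial[OF V(2)] V(3)] by simp
  have linA: "linear A"
    using smooth_on_has_derivative[OF V(2,3)] has_derivative_linear by (auto simp: A_def)
  have linH: "linear H"
    using G has_derivative_linear by (auto simp: twice_diff_at_def)
  have Aw: "A w = (\<Sum>j\<in>UNIV. (w $ j) *\<^sub>R partial j X u)"
    by (simp add: A_def frechet_derivative_partial[OF V(2,3)])
  have "(f' has_derivative (\<lambda>h. g (X (c 0)) \<bullet> (\<Sum>j\<in>UNIV. (w $ j) *\<^sub>R (\<Sum>i\<in>UNIV. ((h *\<^sub>R w) $ i) *\<^sub>R partial i (partial j X) u))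
        + H (A (h *\<^sub>R w)) \<bullet> (\<Sum>j\<in>UNIV. (w $ j) *\<^sub>R partial j X (c 0)))) (at 0)"
    unfolding f'_def
    by (intro has_derivative_inner gX has_derivative_sum has_derivative_scaleR_right pX)
  then have 2: "(f' has_real_derivative (H (A w) \<bullet> A w +
      g (X u) \<bullet> (\<Sum>j\<in>UNIV. \<Sum>i\<in>UNIV. (w $ i * w $ j) *\<^sub>R partial i (partial j X) u))) (at 0)"
    unfolding has_field_derivative_def
    by (rule has_derivative_eq_rhs)
      (simp add: fun_eq_iff linear_scale[OF linA] linear_scale[OF linH] Aw[symmetric] scaleR_sum_right
        inner_sum_right sum_distrib_left distrib_left algebra_simps)
  have 3: "\<forall>\<^sub>F t in nhds 0. G (X (c 0)) \<le> G (X (c t))"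
    using eventually_compose_filterlim[OF min lim] by simp
  show "g (X u) \<bullet> A w = 0"
    using second_derivative_test(1)[OF 1 2 3] by (simp add: f'_def Aw)
  show "H (A w) \<bullet> A w + g (X u) \<bullet> (\<Sum>i\<in>UNIV. \<Sum>j\<in>UNIV. (w $ i * w $ j) *\<^sub>R partial i (partial j X) u) \<ge> 0"
    using second_derivative_test(2)[OF 1 2 3]
    by (subst sum.swap)
qed

text \<open>Summing the second derivative test over an orthonormal frame gives the Hessian trace
  plus the pairing of the gradient with \<open>P\<close>. Since \<open>P + X u\<close> is tangent
  and the gradient is normal, \<open>P\<close> may be replaced by \<open>- X u\<close>, the drift
  term. \<open>B\<close> is fixed before \<open>G\<close>.\<close>

lemma self_shrinker_minimum_principle:
  fixes X :: "real ^ 'm::finite \<Rightarrow> 'b::euclidean_space"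
  assumes V: "open V" "smooth_on V X" "u \<in> V"
    and inj: "inj (frechet_derivative X (at u))"
    and shr: "orth_normal_part (tangent_space X u) (X u) = - mean_curvature_vector X u"
  obtains B where "orthonormal B" "card B = CARD('m)" "span B = range (frechet_derivative X (at u))"
    "\<And>G g H. twice_diff_at G g H (X u) \<Longrightarrow> \<forall>\<^sub>F a in nhds u. G (X u) \<le> G (X a) \<Longrightarrow>
       (\<forall>e\<in>B. g (X u) \<bullet> e = 0) \<and> shrinker_op B (g (X u)) H (X u) \<ge> 0"
proof -
  define A where "A = frechet_derivative X (at u)"
  have linA: "linear A"
    using smooth_on_has_derivative[OF V(2,3)] has_derivative_linear by (auto simp: A_def)
  have TA: "tangent_space X u = range A" by (simp add: tangent_space_def A_def)
  have sub: "subspace (range A)" by (simp add: linA linear_subspace_image)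
  have "dim (range A) = CARD('m)"
    using dim_image_eq[OF linA, of UNIV] inj by (simp add: A_def)
  then obtain B where B: "B \<subseteq> range A" "pairwise orthogonal B" "\<And>e. e \<in> B \<Longrightarrow> norm e = 1"
      "card B = CARD('m)" "span B = range A"
    using orthonormal_basis_subspace[OF sub] by metis
  have on: "orthonormal B" using B by (simp add: orthonormal_def)
  obtain \<beta> where \<beta>: "bij_betw \<beta> (UNIV :: 'm set) B"
    using finite_same_card_bij[of "UNIV :: 'm set" B] B(4) orthonormal_finite[OF on] by auto
  have "\<exists>v. A v = \<beta> i" for i
    using \<beta> B(1) by (metis (no_types, lifting) bij_betwE UNIV_I imageE subsetD)
  then obtain w where w: "\<And>i. A (w i) = \<beta> i" by metis
  have ww: "A (w i) \<bullet> A (w j) = (if i = j then 1 else 0)" for i j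
    using orthonormal_inner[OF on, of "\<beta> i" "\<beta> j"] \<beta> bij_betwE[OF \<beta>]
    by (simp add: w bij_betw_def inj_eq)
  define P where "P = (\<Sum>k\<in>UNIV. \<Sum>i\<in>UNIV. \<Sum>j\<in>UNIV. (w k $ i * w k $ j) *\<^sub>R partial i (partial j X) u)"
  have "P + X u \<in> range A"
    using self_shrinker_trace_tangent[of X u] sub shr
      metric_trace_orthonormal_frame[OF V(2,3), of w "\<lambda>i j. partial i (partial j X) u"] ww
    by (simp add: TA P_def A_def)
  then obtain v where v: "P + X u = A v" by auto
  show ?thesis
  proof (rule that[OF on B(4)])
    show "span B = range (frechet_derivative X (at u))" using B(5) by (simp add: A_def)
    fix G g H
    assume G: "twice_diff_at G g H (X u)" and min: "\<forall>\<^sub>F a in nhds u. G (X u) \<le> G (X a)"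
    note line = second_derivative_along_line[OF V G min, folded A_def]
    have "(\<Sum>k\<in>UNIV. H (A (w k)) \<bullet> A (w k) + g (X u) \<bullet> (\<Sum>i\<in>UNIV. \<Sum>j\<in>UNIV. (w k $ i * w k $ j) *\<^sub>R partial i (partial j X) u)) \<ge> 0"
      by (intro sum_nonneg line(2))
    then have "(\<Sum>k\<in>UNIV. H (\<beta> k) \<bullet> \<beta> k) + g (X u) \<bullet> P \<ge> 0"
      by (simp add: sum.distrib w P_def inner_sum_right)
    moreover have "(\<Sum>k\<in>UNIV. H (\<beta> k) \<bullet> \<beta> k) = (\<Sum>e\<in>B. H e \<bullet> e)"
      by (rule sum.reindex_bij_betw[OF \<beta>])
    moreover have "g (X u) \<bullet> P = - (g (X u) \<bullet> X u)"
      using line(1)[of v] by (simp add: v[symmetric] inner_add_right)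
    ultimately have "shrinker_op B (g (X u)) H (X u) \<ge> 0" by (simp add: shrinker_op_def)
    then show "(\<forall>e\<in>B. g (X u) \<bullet> e = 0) \<and> shrinker_op B (g (X u)) H (X u) \<ge> 0"
      using line(1) B(1) by auto
  qed
qed

section \<open>The strong minimum principle\<close>

lemma isCont_eventually_gt:
  fixes f :: "'a::t2_space \<Rightarrow> real"
  assumes "isCont f p" "f p > c"
  shows "\<forall>\<^sub>F a in nhds p. f a > c"
  using order_tendstoD(1)[of f "f p" "nhds p" c] assms tendsto_at_iff_tendsto_nhds[of f p]
  by (simp add: isCont_def)

lemma twice_diff_at_isCont: "twice_diff_at G g H z \<Longrightarrow> isCont G z"
  unfolding twice_diff_at_def
  using eventually_nhds_x_imp_x has_derivative_continuous by blast

lemma smooth_on_isCont: "smooth_on V X \<Longrightarrow> u \<in> V \<Longrightarrow> isCont X u"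
  using smooth_on_has_derivative has_derivative_continuous by blast

text \<open>On a small ball \<open>X\<close> differs from its linearization at \<open>u\<close> by a
  map with small Lipschitz constant, and the linearization is bounded below. The first inequality
  yields injectivity and, for Hopf's argument, that the chord \<open>X a - X b\<close> is not normal
  to the hypersurface at \<open>X a\<close>.\<close>

lemma immersion_locally_expansive:
  fixes X :: "real ^ 'm::finite \<Rightarrow> 'b::euclidean_space"
  assumes V: "open V" "smooth_on V X" "u \<in> V"
    and inj: "inj (frechet_derivative X (at u))"
  obtains d \<kappa> M where "d > 0" "\<kappa> > 0" "M > 0" "cball u d \<subseteq> V"
    "\<And>a b. a \<in> cball u d \<Longrightarrow> b \<in> cball u d \<Longrightarrow>
       \<kappa> * (norm (a - b))\<^sup>2 \<le> (X a - X b) \<bullet> frechet_derivative X (at a) (a - b)"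
    "\<And>a w. a \<in> cball u d \<Longrightarrow> norm (frechet_derivative X (at a) w) \<le> M * norm w"
    "\<And>a b. a \<in> cball u d \<Longrightarrow> b \<in> cball u d \<Longrightarrow> norm (X a - X b) \<le> M * norm (a - b)"
proof -
  define A where "A = frechet_derivative X (at u)"
  have linA: "linear A"
    using smooth_on_has_derivative[OF V(2,3)] has_derivative_linear by (auto simp: A_def)
  obtain c where c: "c > 0" "\<And>w. c * norm w \<le> norm (A w)"
    using linear_inj_bounded_below_pos[OF linA] inj by (auto simp: A_def)
  obtain C where C: "C > 0" "\<And>w. norm (A w) \<le> C * norm w"
    using linear_bounded_pos[OF linA] by blast
  \<comment> \<open>In the product of \<open>A w + r\<close> and \<open>A w + s\<close> the three
    error terms cost at most \<open>\<eta> * (2 * C + 1)\<close> times the squared norm of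
    \<open>w\<close>, using \<open>\<eta> \<le> 1\<close> for the last one; this choice leaves half
    of \<open>c\<^sup>2\<close>.\<close>
  define \<eta> where "\<eta> = min 1 (c\<^sup>2 / (2 * (2 * C + 1)))"
  have \<eta>: "\<eta> > 0" "\<eta> \<le> 1" using c C by (auto simp: \<eta>_def)
  have "\<eta> \<le> c\<^sup>2 / (2 * (2 * C + 1))" by (simp add: \<eta>_def)
  then have "\<eta> * (2 * (2 * C + 1)) \<le> c\<^sup>2"
    using C by (subst (asm) pos_le_divide_eq) auto
  then have \<eta>C: "\<eta> * (2 * C + 1) \<le> c\<^sup>2 / 2" by (simp add: algebra_simps)
  have "\<forall>\<^sub>F a in nhds u. norm (partial i X a - partial i X u) < \<eta> / CARD('m)" for i
  proof -
    have "isCont (\<lambda>a. - norm (partial i X a - partial i X u)) u"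
      by (intro continuous_intros smooth_on_isCont[OF smooth_on_partial[OF V(2)] V(3)])
    from isCont_eventually_gt[OF this, of "- (\<eta> / CARD('m))"] show ?thesis
      using \<eta> by simp
  qed
  then have "\<forall>\<^sub>F a in nhds u. \<forall>i\<in>UNIV. norm (partial i X a - partial i X u) < \<eta> / CARD('m)"
    by (intro eventually_ball_finite) auto
  moreover have "\<forall>\<^sub>F a in nhds u. a \<in> V" using V by (simp add: eventually_nhds_in_open)
  ultimately have "\<forall>\<^sub>F a in nhds u. a \<in> V \<and> (\<forall>i. norm (partial i X a - partial i X u) < \<eta> / CARD('m))"
    by eventually_elim auto
  then obtain d0 where d0: "d0 > 0" "\<And>a. dist a u < d0 \<Longrightarrow> a \<in> V"
      "\<And>a i. dist a u < d0 \<Longrightarrow> norm (partial i X a - partial i X u) < \<eta> / CARD('m)"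
    unfolding eventually_nhds_metric by blast
  define d where "d = d0 / 2"
  have d: "d > 0" "cball u d \<subseteq> V"
    and near: "\<And>a i. a \<in> cball u d \<Longrightarrow> norm (partial i X a - partial i X u) < \<eta> / CARD('m)"
    using d0 by (auto simp: d_def dist_commute)
  have DX: "norm (frechet_derivative X (at a) w - A w) \<le> \<eta> * norm w" if "a \<in> cball u d" for a w
  proof -
    have "frechet_derivative X (at a) w - A w = (\<Sum>i\<in>UNIV. (w $ i) *\<^sub>R (partial i X a - partial i X u))"
      using that d(2) V unfolding A_def
      by (simp add: frechet_derivative_partial[OF V(2)] subset_iff scaleR_diff_right sum_subtractf)
    also have "norm \<dots> \<le> (\<Sum>i\<in>(UNIV :: 'm set). norm w * (\<eta> / CARD('m)))"
    proof (rule sum_norm_le)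
      fix i
      show "norm ((w $ i) *\<^sub>R (partial i X a - partial i X u)) \<le> norm w * (\<eta> / CARD('m))"
        using mult_mono[OF component_le_norm_cart[of w i] less_imp_le[OF near[OF that, of i]]] by simp
    qed
    also have "\<dots> = \<eta> * norm w" by simp
    finally show ?thesis .
  qed
  have rem: "norm (X a - X b - A (a - b)) \<le> \<eta> * norm (a - b)" if "a \<in> cball u d" "b \<in> cball u d" for a b
  proof -
    have "norm ((X a - A a) - (X b - A b)) \<le> \<eta> * norm (a - b)"
    proof (rule differentiable_bound[of "cball u d" "\<lambda>a. X a - A a" "\<lambda>a w. frechet_derivative X (at a) w - A w"])
      fix a assume a: "a \<in> cball u d"
      show "((\<lambda>a. X a - A a) has_derivative (\<lambda>w. frechet_derivative X (at a) w - A w)) (at a within cball u d)"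
        using smooth_on_has_derivative[OF V(2) subsetD[OF d(2) a]] linear_imp_has_derivative[OF linA]
        by (intro has_derivative_diff) (auto intro: has_derivative_at_withinI)
      show "onorm (\<lambda>w. frechet_derivative X (at a) w - A w) \<le> \<eta>"
        using DX[OF a] \<eta> by (intro onorm_bound) auto
    qed (use that in auto)
    then show ?thesis by (simp add: linear_diff[OF linA] algebra_simps)
  qed
  show ?thesis
  proof (rule that[of d "c\<^sup>2 / 2" "C + 1"])
    show "norm (frechet_derivative X (at a) w) \<le> (C + 1) * norm w" if "a \<in> cball u d" for a w
    proof -
      have "norm (frechet_derivative X (at a) w) \<le> norm (A w) + norm (frechet_derivative X (at a) w - A w)"
        by (rule norm_triangle_sub)
      also have "\<dots> \<le> C * norm w + 1 * norm w"
        using DX[OF that, of w] C(2)[of w] \<eta>(2) mult_right_mono[OF \<eta>(2) norm_ge_zero[of w]] by linarith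
      finally show ?thesis by (simp add: distrib_right)
    qed
    show "norm (X a - X b) \<le> (C + 1) * norm (a - b)" if "a \<in> cball u d" "b \<in> cball u d" for a b
    proof -
      have "norm (X a - X b) \<le> norm (A (a - b)) + norm (X a - X b - A (a - b))"
        by (rule norm_triangle_sub)
      also have "\<dots> \<le> C * norm (a - b) + 1 * norm (a - b)"
        using rem[OF that] C(2)[of "a - b"] mult_right_mono[OF \<eta>(2) norm_ge_zero[of "a - b"]] by linarith
      finally show ?thesis by (simp add: distrib_right)
    qed
    show "c\<^sup>2 / 2 * (norm (a - b))\<^sup>2 \<le> (X a - X b) \<bullet> frechet_derivative X (at a) (a - b)"
      if ab: "a \<in> cball u d" "b \<in> cball u d" for a b
    proof -
      define w where "w = a - b"
      define r where "r = X a - X b - A w"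
      define s where "s = frechet_derivative X (at a) w - A w"
      have rs: "norm r \<le> \<eta> * norm w" "norm s \<le> \<eta> * norm w"
        using rem[OF ab] DX[OF ab(1)] by (auto simp: r_def s_def w_def)
      have "(X a - X b) \<bullet> frechet_derivative X (at a) w = (A w + r) \<bullet> (A w + s)"
        by (simp add: r_def s_def)
      also have "\<dots> = (norm (A w))\<^sup>2 + A w \<bullet> s + r \<bullet> A w + r \<bullet> s"
        by (simp add: inner_add_left inner_add_right power2_norm_eq_inner)
      also have "\<dots> \<ge> c\<^sup>2 * (norm w)\<^sup>2 - C * norm w * (\<eta> * norm w) - \<eta> * norm w * (C * norm w)
          - \<eta> * norm w * (1 * norm w)"
      proof -
        have "(c * norm w)\<^sup>2 \<le> (norm (A w))\<^sup>2"
          using c by (intro power_mono) auto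
        moreover have "\<bar>A w \<bullet> s\<bar> \<le> C * norm w * (\<eta> * norm w)"
          by (rule order_trans[OF Cauchy_Schwarz_ineq2], rule mult_mono) (use C rs in auto)
        moreover have "\<bar>r \<bullet> A w\<bar> \<le> \<eta> * norm w * (C * norm w)"
          by (rule order_trans[OF Cauchy_Schwarz_ineq2], rule mult_mono) (use C \<eta> rs in auto)
        moreover have "norm s \<le> 1 * norm w"
          using rs(2) mult_right_mono[OF \<eta>(2) norm_ge_zero[of w]] by linarith
        then have "\<bar>r \<bullet> s\<bar> \<le> \<eta> * norm w * (1 * norm w)"
          by (intro order_trans[OF Cauchy_Schwarz_ineq2] mult_mono) (use \<eta> rs in auto)
        ultimately show ?thesis unfolding power_mult_distrib abs_le_iff by linarith
      qed
      also (xtrans) have "c\<^sup>2 * (norm w)\<^sup>2 - C * norm w * (\<eta> * norm w) - \<eta> * norm w * (C * norm w)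
          - \<eta> * norm w * (1 * norm w) = (c\<^sup>2 - \<eta> * (2 * C + 1)) * (norm w)\<^sup>2"
        by (simp add: algebra_simps power2_eq_square)
      also (xtrans) have "\<dots> \<ge> (c\<^sup>2 / 2) * (norm w)\<^sup>2"
        using \<eta>C by (intro mult_right_mono) auto
      finally show ?thesis by (simp add: w_def)
    qed
  qed (use d c C in auto)
qed

text \<open>A projection onto a space is at least as long as the projection onto one direction in
  it. The left side can vary continuously with the point, so no continuous choice of orthonormal
  frames is needed.\<close>

lemma tangential_part_lower_bound:
  assumes B: "orthonormal B" and t: "t \<in> span B" "t \<noteq> 0"
  shows "(y \<bullet> t)\<^sup>2 / (t \<bullet> t) \<le> (\<Sum>e\<in>B. (y \<bullet> e)\<^sup>2)"
proof -
  have "(y \<bullet> t)\<^sup>2 \<le> (\<Sum>e\<in>B. (y \<bullet> e)\<^sup>2) * (\<Sum>e\<in>B. (t \<bullet> e)\<^sup>2)"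
    unfolding orthonormal_parseval[OF B t(1), of y] by (rule Cauchy_Schwarz_ineq_sum)
  also have "(\<Sum>e\<in>B. (t \<bullet> e)\<^sup>2) = t \<bullet> t"
    using orthonormal_parseval[OF B t(1), of t] by (simp add: power2_eq_square)
  finally show ?thesis using t(2) by (simp add: divide_le_eq)
qed

text \<open>The tangent spaces of the shrinker do not enter: the differential inequality is asked for every
  \<open>m\<close>-dimensional subspace, spanned by \<open>B\<close>.\<close>

definition shrinker_barrier :: "nat \<Rightarrow> 'b::euclidean_space set \<Rightarrow> ('b \<Rightarrow> real) \<Rightarrow> bool" where
  "shrinker_barrier m S v \<longleftrightarrow>
     (\<forall>z\<in>S. v z \<ge> 0 \<and> (\<exists>g H. twice_diff_at v g H z \<and>
        (\<forall>B. orthonormal B \<longrightarrow> card B = m \<longrightarrow>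
           shrinker_op B (g z) H z \<le> 0 \<and> (v z > 0 \<longrightarrow> shrinker_op B (g z) H z < 0))))"

text \<open>For large \<open>K\<close> the term \<open>2K|\<nabla>|z - c|\<^sup>2|\<^sup>2\<close> makes this a strict subsolution on the shrinker
  near points at which \<open>z - c\<close> is not normal to it.\<close>

definition hopf_profile :: "real \<Rightarrow> 'b::euclidean_space \<Rightarrow> real \<Rightarrow> 'b \<Rightarrow> real" where
  "hopf_profile K c R z = (R - (z - c) \<bullet> (z - c)) + K * (R - (z - c) \<bullet> (z - c))\<^sup>2"

lemma hopf_profile_op:
  fixes c :: "'b::euclidean_space"
  obtains g H where "twice_diff_at (hopf_profile K c R) g H z"
    "\<And>B. orthonormal B \<Longrightarrow> shrinker_op B (g z) H z
       = (- 1 - 2 * K * (R - (z - c) \<bullet> (z - c))) * (2 * real (card B) - 2 * ((z - c) \<bullet> z))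
         + 8 * K * (\<Sum>e\<in>B. ((z - c) \<bullet> e)\<^sup>2)"
proof -
  let ?\<sigma> = "\<lambda>y. (y - c) \<bullet> (y - c)"
  \<comment> \<open>The profile is a quadratic function of the squared distance; its second
    derivative \<open>2 * K\<close> meets the gradient \<open>2 *\<^sub>R (z - c)\<close>, hence the
    factor \<open>8 * K\<close>.\<close>
  have 1: "((\<lambda>t. (R - t) + K * (R - t)\<^sup>2) has_real_derivative - 1 - 2 * K * (R - t)) (at t)" for t
    by (auto intro!: derivative_eq_intros simp: algebra_simps)
  have 2: "((\<lambda>t. - 1 - 2 * K * (R - t)) has_real_derivative 2 * K) (at t)" for t
    by (auto intro!: derivative_eq_intros)
  note td = twice_diff_at_compose[OF twice_diff_at_dist_square[of c z] 1 2 open_UNIV UNIV_I]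
  have eq: "hopf_profile K c R = (\<lambda>y. (R - ?\<sigma> y) + K * (R - ?\<sigma> y)\<^sup>2)"
    by (simp add: fun_eq_iff hopf_profile_def)
  show ?thesis
  proof (rule that[OF td[folded eq]])
    fix B :: "'b set" assume B: "orthonormal B"
    have "(\<Sum>e\<in>B. ((2 *\<^sub>R (z - c)) \<bullet> e)\<^sup>2) = 4 * (\<Sum>e\<in>B. ((z - c) \<bullet> e)\<^sup>2)"
      by (simp add: power_mult_distrib sum_distrib_left)
    then show "shrinker_op B ((- 1 - 2 * K * (R - ?\<sigma> z)) *\<^sub>R 2 *\<^sub>R (z - c))
       (\<lambda>h. (- 1 - 2 * K * (R - ?\<sigma> z)) *\<^sub>R 2 *\<^sub>R h + (2 * K * ((2 *\<^sub>R (z - c)) \<bullet> h)) *\<^sub>R 2 *\<^sub>R (z - c)) z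
       = (- 1 - 2 * K * (R - ?\<sigma> z)) * (2 * real (card B) - 2 * ((z - c) \<bullet> z))
         + 8 * K * (\<Sum>e\<in>B. ((z - c) \<bullet> e)\<^sup>2)"
      by (simp only: shrinker_op_compose shrinker_op_dist_square[OF B])
  qed
qed

text \<open>At \<open>p\<close> the term \<open>R - (X p - c) \<bullet> (X p - c)\<close> vanishes,
  so the operator is at least \<open>8 * K * E p - Q p\<close>; continuity extends positivity to
  nearby points. This is why a quadratic profile can replace Hopf's exponential. The first conjunct
  makes the sign of the profile that of \<open>R - (X a - c) \<bullet> (X a - c)\<close>.\<close>

lemma hopf_profile_subsolution:
  fixes X :: "real ^ 'm::finite \<Rightarrow> 'b::euclidean_space" and c :: 'b
  assumes V: "open V" "smooth_on V X" "p \<in> V"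
    and w: "(X p - c) \<bullet> frechet_derivative X (at p) w > 0"
  defines "R \<equiv> (X p - c) \<bullet> (X p - c)"
  obtains K where
    "\<forall>\<^sub>F a in nhds p. 1 + K * (R - (X a - c) \<bullet> (X a - c)) > 0 \<and>
      (\<exists>g H. twice_diff_at (hopf_profile K c R) g H (X a) \<and>
        (\<forall>B. orthonormal B \<longrightarrow> card B = CARD('m) \<longrightarrow> span B = range (frechet_derivative X (at a))
           \<longrightarrow> shrinker_op B (g (X a)) H (X a) > 0))"
proof -
  define D where "D = (\<lambda>a. \<Sum>j\<in>UNIV. (w $ j) *\<^sub>R partial j X a)"
  have D: "D a = frechet_derivative X (at a) w" if "a \<in> V" for a
    using frechet_derivative_partial[OF V(2) that] by (simp add: D_def)
  have Xc: "isCont X p" using smooth_on_isCont[OF V(2,3)] .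
  have Dc: "isCont D p"
    unfolding D_def by (intro continuous_intros smooth_on_isCont[OF smooth_on_partial[OF V(2)] V(3)])
  have wD: "(X p - c) \<bullet> D p > 0" using w by (simp add: D[OF V(3)])
  then have "D p \<noteq> 0" by auto
  define E where "E = (\<lambda>a. ((X a - c) \<bullet> D a)\<^sup>2 / (D a \<bullet> D a))"
  define Q where "Q = (\<lambda>a. 2 * real CARD('m) - 2 * ((X a - c) \<bullet> X a))"
  have Ep: "E p > 0" using wD \<open>D p \<noteq> 0\<close> by (simp add: E_def)
  define K where "K = (\<bar>Q p\<bar> + 1) / (8 * E p)"
  have K: "K > 0" "8 * K * E p > Q p" using Ep by (auto simp: K_def add_pos_nonneg add_nonneg_pos)
  define J where "J = (\<lambda>a. (- 1 - 2 * K * (R - (X a - c) \<bullet> (X a - c))) * Q a + 8 * K * E a)"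
  have "isCont J p"
    unfolding J_def E_def Q_def using \<open>D p \<noteq> 0\<close> by (intro continuous_intros Xc Dc) auto
  moreover have "J p > 0" using K by (simp add: J_def R_def)
  ultimately have J: "\<forall>\<^sub>F a in nhds p. J a > 0" by (rule isCont_eventually_gt)
  have "isCont (\<lambda>a. 1 + K * (R - (X a - c) \<bullet> (X a - c))) p"
    by (intro continuous_intros Xc)
  then have pos: "\<forall>\<^sub>F a in nhds p. 1 + K * (R - (X a - c) \<bullet> (X a - c)) > 0"
    by (rule isCont_eventually_gt) (simp add: R_def)
  have "isCont (\<lambda>a. D a \<bullet> D a) p" by (intro continuous_intros Dc)
  then have D0: "\<forall>\<^sub>F a in nhds p. D a \<bullet> D a > 0"
    by (rule isCont_eventually_gt) (simp add: \<open>D p \<noteq> 0\<close>)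
  have inV: "\<forall>\<^sub>F a in nhds p. a \<in> V" using V by (simp add: eventually_nhds_in_open)
  from J pos D0 inV
  have "\<forall>\<^sub>F a in nhds p. 1 + K * (R - (X a - c) \<bullet> (X a - c)) > 0 \<and>
      (\<exists>g H. twice_diff_at (hopf_profile K c R) g H (X a) \<and>
        (\<forall>B. orthonormal B \<longrightarrow> card B = CARD('m) \<longrightarrow> span B = range (frechet_derivative X (at a))
           \<longrightarrow> shrinker_op B (g (X a)) H (X a) > 0))"
  proof eventually_elim
    case (elim a)
    obtain g H where gH: "twice_diff_at (hopf_profile K c R) g H (X a)"
      "\<And>B. orthonormal B \<Longrightarrow> shrinker_op B (g (X a)) H (X a)
         = (- 1 - 2 * K * (R - (X a - c) \<bullet> (X a - c))) * (2 * real (card B) - 2 * ((X a - c) \<bullet> X a))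
           + 8 * K * (\<Sum>e\<in>B. ((X a - c) \<bullet> e)\<^sup>2)"
      using hopf_profile_op[of K c R "X a"] by blast
    have "shrinker_op B (g (X a)) H (X a) > 0"
      if B: "orthonormal B" "card B = CARD('m)" "span B = range (frechet_derivative X (at a))" for B
    proof -
      have "E a \<le> (\<Sum>e\<in>B. ((X a - c) \<bullet> e)\<^sup>2)"
        unfolding E_def by (rule tangential_part_lower_bound[OF B(1)]) (use elim B D in auto)
      then have "8 * K * E a \<le> 8 * K * (\<Sum>e\<in>B. ((X a - c) \<bullet> e)\<^sup>2)"
        using K by (intro mult_left_mono) auto
      then show ?thesis
        using elim(1) B by (simp add: gH(2) J_def Q_def)
    qed
    then show ?case using elim gH(1) by blast
  qed
  then show ?thesis by (rule that)
qed

lemma shrinker_barrier_subset: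
  "shrinker_barrier m T v \<Longrightarrow> S \<subseteq> T \<Longrightarrow> shrinker_barrier m S v"
  unfolding shrinker_barrier_def by blast

lemma shrinker_barrier_cont:
  assumes "shrinker_barrier m S v" "z \<in> S"
  shows "isCont v z"
  using assms twice_diff_at_isCont unfolding shrinker_barrier_def by blast

text \<open>Hopf's argument, with the barrier taken on ambient balls instead of balls in the chart: the
  ball around the midpoint of \<open>X p\<close> and \<open>X q\<close> touches the zero set of \<open>v\<close> in \<open>X p\<close> only.\<close>

lemma shrinker_strong_minimum_principle:
  fixes X :: "real ^ 'm::finite \<Rightarrow> 'b::euclidean_space"
  assumes V: "open V" "smooth_on V X" "u \<in> V"
    and inj: "\<And>a. a \<in> V \<Longrightarrow> inj (frechet_derivative X (at a))"
    and shr: "\<And>a. a \<in> V \<Longrightarrow> orth_normal_part (tangent_space X a) (X a) = - mean_curvature_vector X a"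
    and v: "shrinker_barrier CARD('m) (X ` V) v" and vu: "v (X u) = 0"
  shows "\<forall>\<^sub>F a in nhds u. v (X a) = 0"
proof (rule ccontr)
  assume neg: "\<not> (\<forall>\<^sub>F a in nhds u. v (X a) = 0)"
  obtain d \<kappa> M where dkM: "d > 0" "\<kappa> > 0" "M > 0" "cball u d \<subseteq> V"
    and expansive: "\<And>a b. a \<in> cball u d \<Longrightarrow> b \<in> cball u d \<Longrightarrow>
       \<kappa> * (norm (a - b))\<^sup>2 \<le> (X a - X b) \<bullet> frechet_derivative X (at a) (a - b)"
    and DM: "\<And>a w. a \<in> cball u d \<Longrightarrow> norm (frechet_derivative X (at a) w) \<le> M * norm w"
    and LM: "\<And>a b. a \<in> cball u d \<Longrightarrow> b \<in> cball u d \<Longrightarrow> norm (X a - X b) \<le> M * norm (a - b)"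
    using immersion_locally_expansive[OF V inj[OF V(3)]] by blast
  have injX: "a = b" if "a \<in> cball u d" "b \<in> cball u d" "X a = X b" for a b
    using expansive[OF that(1,2)] that(3) dkM(2) by (simp add: mult_le_0_iff)
  have nonneg: "v (X a) \<ge> 0" if "a \<in> V" for a
    using v that by (auto simp: shrinker_barrier_def)
  have Xc: "isCont X a" if "a \<in> V" for a
    using smooth_on_isCont[OF V(2) that] .
  have vc: "isCont (\<lambda>a. v (X a)) a" if "a \<in> V" for a
    using isCont_o2[OF Xc[OF that] shrinker_barrier_cont[OF v imageI[OF that]]] .

  \<comment> \<open>Below, \<open>p\<close> is shown to be within
    \<open>M\<^sup>2 / \<kappa> * e\<close> of \<open>q\<close>, hence within
    \<open>N * e = d / 2\<close> of \<open>u\<close>. So \<open>p\<close> is interior to the ball on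
    which the estimates hold.\<close>
  define N where "N = 1 + M\<^sup>2 / \<kappa>"
  define e where "e = d / (2 * N)"
  have N: "N \<ge> 1" using dkM by (simp add: N_def)
  have e: "e > 0" "N * e = d / 2"
    using N dkM(1) by (auto simp: e_def)
  have ed: "e < d"
    using mult_right_mono[OF N, of e] e dkM(1) by simp
  obtain q where q: "dist q u < e" "v (X q) \<noteq> 0"
    using neg e(1) unfolding eventually_nhds_metric by blast
  have qD: "q \<in> cball u d" using q(1) ed by (simp add: dist_commute)
  have qV: "q \<in> V" using qD dkM(4) by blast
  have uD: "u \<in> cball u d" using dkM(1) by simp

  define Z where "Z = {a \<in> cball u d. v (X a) = 0}"
  have "continuous_on (cball u d) (\<lambda>a. v (X a))"
    using vc dkM(4) by (intro continuous_at_imp_continuous_on) blast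
  then have "closed Z"
    unfolding Z_def by (intro continuous_closed_preimage_constant) auto
  moreover have "bounded Z"
    unfolding Z_def using bounded_cball by (rule bounded_subset) auto
  ultimately have "compact Z" by (simp add: compact_eq_bounded_closed)
  moreover have "u \<in> Z" using uD vu by (simp add: Z_def)
  moreover have "continuous_on Z (\<lambda>a. norm (X a - X q))"
    using Xc dkM(4) unfolding Z_def
    by (intro continuous_at_imp_continuous_on ballI continuous_intros) blast
  ultimately obtain p where p: "p \<in> Z" "\<And>a. a \<in> Z \<Longrightarrow> norm (X p - X q) \<le> norm (X a - X q)"
    using continuous_attains_inf[of Z "\<lambda>a. norm (X a - X q)"] by blast
  have pD: "p \<in> cball u d" and vp: "v (X p) = 0" using p(1) by (auto simp: Z_def)
  have pV: "p \<in> V" using pD dkM(4) by blast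
  have pq: "p \<noteq> q" using vp q(2) by auto

  have "\<kappa> * norm (p - q) * norm (p - q) \<le> M * norm (X p - X q) * norm (p - q)"
  proof -
    have "\<kappa> * (norm (p - q))\<^sup>2 \<le> norm (X p - X q) * norm (frechet_derivative X (at p) (p - q))"
      using expansive[OF pD qD] norm_cauchy_schwarz order_trans by blast
    also have "\<dots> \<le> norm (X p - X q) * (M * norm (p - q))"
      by (intro mult_left_mono DM pD) auto
    finally show ?thesis by (simp add: power2_eq_square mult_ac)
  qed
  then have "\<kappa> * norm (p - q) \<le> M * norm (X p - X q)"
    using pq by (simp add: mult_le_cancel_right)
  also have "\<dots> \<le> M * (M * e)"
  proof -
    have "norm (X p - X q) \<le> norm (X u - X q)" by (rule p(2)[OF \<open>u \<in> Z\<close>])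
    also have "\<dots> \<le> M * norm (u - q)" by (rule LM[OF uD qD])
    also have "\<dots> \<le> M * e" using q(1) dkM(3) by (simp add: dist_norm norm_minus_commute)
    finally show ?thesis using dkM(3) by simp
  qed
  finally have "norm (p - q) \<le> M\<^sup>2 / \<kappa> * e"
    using dkM(2) by (simp add: field_simps power2_eq_square)
  then have "dist p u < d / 2"
    using q(1) e(2) dist_triangle[of p u q] unfolding N_def distrib_right dist_norm by linarith
  then have pu: "dist p u < d" using dkM(1) by simp

  \<comment> \<open>The ball about the midpoint through \<open>X p\<close> is internally tangent at
    \<open>X p\<close> to the ball of radius |X p - X q| about \<open>X q\<close>, whose interior
    contains no image of a point of \<open>Z\<close>.\<close>
  define c where "c = (1/2) *\<^sub>R (X p + X q)"
  define R where "R = (X p - c) \<bullet> (X p - c)"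
  have Xpc: "X p - c = (1/2) *\<^sub>R (X p - X q)" and Xqc: "X q - c = - (X p - c)"
    by (simp_all add: c_def algebra_simps scaleR_half_double[symmetric] flip: scaleR_add_left)
  have "(X p - X q) \<bullet> frechet_derivative X (at p) (p - q) > 0"
    by (rule less_le_trans[OF _ expansive[OF pD qD]]) (use pq dkM in auto)
  then have "(X p - c) \<bullet> frechet_derivative X (at p) (p - q) > 0"
    by (simp add: Xpc)
  then obtain K where K: "\<forall>\<^sub>F a in nhds p. 1 + K * (R - (X a - c) \<bullet> (X a - c)) > 0 \<and>
      (\<exists>g H. twice_diff_at (hopf_profile K c R) g H (X a) \<and>
        (\<forall>B. orthonormal B \<longrightarrow> card B = CARD('m) \<longrightarrow> span B = range (frechet_derivative X (at a))
           \<longrightarrow> shrinker_op B (g (X a)) H (X a) > 0))"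
    using hopf_profile_subsolution[OF V(1,2) pV, of c "p - q"] unfolding R_def by blast
  define h where "h = hopf_profile K c R"
  have h: "h z = (R - (z - c) \<bullet> (z - c)) * (1 + K * (R - (z - c) \<bullet> (z - c)))" for z
    by (simp add: h_def hopf_profile_def power2_eq_square algebra_simps)
  obtain s0 where s0: "s0 > 0" "\<And>a. dist a p < s0 \<Longrightarrow> 1 + K * (R - (X a - c) \<bullet> (X a - c)) > 0"
     "\<And>a. dist a p < s0 \<Longrightarrow> (\<exists>g H. twice_diff_at h g H (X a) \<and>
        (\<forall>B. orthonormal B \<longrightarrow> card B = CARD('m) \<longrightarrow> span B = range (frechet_derivative X (at a))
           \<longrightarrow> shrinker_op B (g (X a)) H (X a) > 0))"
    using K unfolding eventually_nhds_metric h_def by blast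
  define s where "s = min (s0 / 2) (d - dist p u)"
  have s: "s > 0" "s < s0" using s0(1) pu by (auto simp: s_def)
  have sD: "cball p s \<subseteq> cball u d"
  proof
    fix a assume "a \<in> cball p s"
    then have "dist p a \<le> d - dist p u" by (simp add: s_def)
    then show "a \<in> cball u d" using dist_triangle[of u a p] by (simp add: dist_commute)
  qed
  have sV: "cball p s \<subseteq> V" using sD dkM(4) by blast
  have hc: "continuous_on (cball p s) (\<lambda>a. h (X a))"
    unfolding h using Xc sV
    by (intro continuous_at_imp_continuous_on ballI continuous_intros) blast+
  have vcs: "continuous_on (cball p s) (\<lambda>a. v (X a))"
    using vc sV by (intro continuous_at_imp_continuous_on) blast

  \<comment> \<open>On the rest of the sphere \<open>h (X a)\<close> is negative, which alone makes
    \<open>f\<close> positive. On \<open>S\<close> positivity must come from \<open>v\<close>, which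
    by tangency and injectivity has no zero there.\<close>
  define S where "S = {a \<in> cball p s. a \<in> sphere p s \<and> (X a - c) \<bullet> (X a - c) \<le> R}"
  have vS: "v (X a) > 0" if a: "a \<in> S" for a
  proof (rule ccontr)
    assume "\<not> v (X a) > 0"
    moreover have aD: "a \<in> cball u d" using a sD by (auto simp: S_def)
    ultimately have "a \<in> Z" using nonneg[of a] dkM(4) by (auto simp: Z_def)
    have "norm (2 *\<^sub>R (X p - c)) \<le> norm (X a - X q)"
      using p(2)[OF \<open>a \<in> Z\<close>] by (simp add: Xpc)
    then have "(2 *\<^sub>R (X p - c)) \<bullet> (2 *\<^sub>R (X p - c)) \<le> (X a - X q) \<bullet> (X a - X q)"
      by (rule norm_le[THEN iffD1])
    moreover have "X a - X q = (X a - c) + (X p - c)"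
      using Xqc by (simp add: algebra_simps)
    ultimately have "4 * R \<le> (X a - c) \<bullet> (X a - c) + 2 * ((X a - c) \<bullet> (X p - c)) + R"
      by (simp add: inner_add_left inner_add_right R_def inner_commute)
    moreover have "((X a - c) - (X p - c)) \<bullet> ((X a - c) - (X p - c))
        = (X a - c) \<bullet> (X a - c) - 2 * ((X a - c) \<bullet> (X p - c)) + R"
      unfolding R_def by (simp add: inner_diff_left inner_diff_right inner_commute)
    moreover have "(X a - c) \<bullet> (X a - c) \<le> R" using a by (simp add: S_def)
    ultimately have "((X a - c) - (X p - c)) \<bullet> ((X a - c) - (X p - c)) \<le> 0" by linarith
    then have "X a = X p" using inner_gt_zero_iff[of "X a - X p"] by (simp flip: not_less)
    then have "a = p" using injX[OF aD pD] by simp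
    then show False using a s(1) by (simp add: S_def)
  qed
  have "continuous_on (cball p s) (\<lambda>a. (X a - c) \<bullet> (X a - c))"
    using Xc sV by (intro continuous_at_imp_continuous_on ballI continuous_intros) blast+
  then have "closed {a \<in> cball p s. (X a - c) \<bullet> (X a - c) \<le> R}"
    using continuous_closed_preimage[of "cball p s" _ "{..R}"] by (simp add: vimage_def Int_def)
  then have "closed ({a \<in> cball p s. (X a - c) \<bullet> (X a - c) \<le> R} \<inter> sphere p s)"
    by (intro closed_Int) auto
  also have "{a \<in> cball p s. (X a - c) \<bullet> (X a - c) \<le> R} \<inter> sphere p s = S"
    by (auto simp: S_def)
  finally have "closed S" .
  have Ssub: "S \<subseteq> cball p s" by (auto simp: S_def)
  have "compact S"
    using \<open>closed S\<close> bounded_subset[OF bounded_cball Ssub] compact_eq_bounded_closed by blast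
  obtain \<delta> where \<delta>: "\<delta> > 0" "\<And>a. a \<in> S \<Longrightarrow> \<delta> \<le> v (X a)"
  proof (cases "S = {}")
    case True then show ?thesis using that[of 1] by simp
  next
    case False
    then obtain a where "a \<in> S" "\<And>b. b \<in> S \<Longrightarrow> v (X a) \<le> v (X b)"
      using continuous_attains_inf[OF \<open>compact S\<close> _ continuous_on_subset[OF vcs Ssub]] by blast
    then show ?thesis using that[of "v (X a)"] vS by blast
  qed
  have "bounded ((\<lambda>a. h (X a)) ` cball p s)"
    using compact_continuous_image[OF hc compact_cball] compact_imp_bounded by blast
  then obtain L where L: "L > 0" "\<And>a. a \<in> cball p s \<Longrightarrow> \<bar>h (X a)\<bar> \<le> L"
    unfolding bounded_pos by auto
  \<comment> \<open>On \<open>S\<close> the subtracted term is at most \<open>\<delta> / 2\<close>,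
    while \<open>v\<close> is at least \<open>\<delta>\<close>.\<close>
  define \<epsilon> where "\<epsilon> = \<delta> / (2 * L)"
  have \<epsilon>: "\<epsilon> > 0" "\<epsilon> * L < \<delta>" using \<delta> L by (auto simp: \<epsilon>_def)
  define f where "f = (\<lambda>a. v (X a) + (- \<epsilon>) * h (X a))"
  have "continuous_on (cball p s) f"
    unfolding f_def by (intro continuous_intros vcs hc)
  then obtain a where a: "a \<in> cball p s" "\<And>b. b \<in> cball p s \<Longrightarrow> f a \<le> f b"
    using continuous_attains_inf[of "cball p s" f] s(1) by auto
  have fp: "f p = 0" by (simp add: f_def vp h R_def)
  have fs: "f b > 0" if b: "b \<in> sphere p s" for b
  proof (cases "b \<in> S")
    case True
    have "\<epsilon> * h (X b) \<le> \<epsilon> * L"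
      using L(2)[of b] b \<epsilon>(1) by (intro mult_left_mono) auto
    then show ?thesis using \<delta>(2)[OF True] \<epsilon>(2) by (simp add: f_def)
  next
    case False
    then have "R < (X b - c) \<bullet> (X b - c)" using b by (auto simp: S_def)
    moreover have "dist b p < s0" using b s by (simp add: dist_commute)
    ultimately have "h (X b) < 0"
      unfolding h using s0(2)[of b] by (intro mult_neg_pos) auto
    then have "\<epsilon> * h (X b) < 0" using \<epsilon>(1) by (simp add: mult_pos_neg)
    moreover have "v (X b) \<ge> 0" using nonneg[of b] b sV by auto
    ultimately show ?thesis by (simp add: f_def)
  qed
  \<comment> \<open>Since \<open>f p = 0\<close> and \<open>f\<close> is positive on the boundary
    sphere, the minimum is interior. There the operator of \<open>v\<close> is at most 0 and that of
    \<open>h\<close> positive, against the minimum principle.\<close>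
  have "f a \<le> 0" using a(2)[of p] s(1) fp by simp
  then have "a \<notin> sphere p s" using fs[of a] by auto
  then have aball: "a \<in> ball p s" using a(1) by auto
  then have "\<forall>\<^sub>F b in nhds a. b \<in> ball p s" by (rule eventually_nhds_in_open[OF open_ball])
  then have min: "\<forall>\<^sub>F b in nhds a. v (X a) + (- \<epsilon>) * h (X a) \<le> v (X b) + (- \<epsilon>) * h (X b)"
    by (rule eventually_mono) (use a(2) in \<open>auto simp: f_def\<close>)
  have aV: "a \<in> V" using a(1) sV by blast
  have "dist a p < s0" using aball s by (simp add: dist_commute)
  then obtain gh Hh where gh: "twice_diff_at h gh Hh (X a)"
      "\<And>B. orthonormal B \<Longrightarrow> card B = CARD('m) \<Longrightarrow> span B = range (frechet_derivative X (at a))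
           \<Longrightarrow> shrinker_op B (gh (X a)) Hh (X a) > 0"
    using s0(3) by blast
  obtain gv Hv where gv: "twice_diff_at v gv Hv (X a)"
      "\<And>B. orthonormal B \<Longrightarrow> card B = CARD('m) \<Longrightarrow> shrinker_op B (gv (X a)) Hv (X a) \<le> 0"
    using v aV unfolding shrinker_barrier_def by blast
  obtain B where B: "orthonormal B" "card B = CARD('m)" "span B = range (frechet_derivative X (at a))"
    and Bmin: "\<And>G g H. twice_diff_at G g H (X a) \<Longrightarrow> \<forall>\<^sub>F b in nhds a. G (X a) \<le> G (X b) \<Longrightarrow>
       (\<forall>e\<in>B. g (X a) \<bullet> e = 0) \<and> shrinker_op B (g (X a)) H (X a) \<ge> 0"
    using self_shrinker_minimum_principle[OF V(1,2) aV inj[OF aV] shr[OF aV]] by metis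
  have "0 \<le> shrinker_op B (gv (X a)) Hv (X a) + (- \<epsilon>) * shrinker_op B (gh (X a)) Hh (X a)"
    using Bmin[OF twice_diff_at_linear_combination[OF gv(1) gh(1), of "- \<epsilon>"] min]
    unfolding shrinker_op_linear_combination by blast
  moreover have "\<epsilon> * shrinker_op B (gh (X a)) Hh (X a) > 0"
    using gh(2)[OF B] \<epsilon>(1) by simp
  ultimately show False using gv(2)[OF B(1,2)] by simp
qed

section \<open>Passage from parametrizations to the manifold\<close>

lemma self_shrinker_chart:
  fixes x :: "'s::{t2_space, second_countable_topology} \<Rightarrow> 'b::euclidean_space"
    and \<A> :: "('s, 'm::finite) chart set"
  assumes "self_shrinker \<A> x"
  obtains U and V :: "(real ^ 'm) set" and \<phi> X where "open U" "p \<in> U" "isCont \<phi> p" "V = \<phi> ` U"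
    "open V" "smooth_on V X" "\<And>q. q \<in> U \<Longrightarrow> X (\<phi> q) = x q" "X ` V \<subseteq> range x"
    "\<And>a. a \<in> V \<Longrightarrow> inj (frechet_derivative X (at a))"
    "\<And>a. a \<in> V \<Longrightarrow> orth_normal_part (tangent_space X a) (X a) = - mean_curvature_vector X a"
    "\<And>P. \<forall>\<^sub>F q in nhds p. P (x q) \<Longrightarrow> \<forall>\<^sub>F a in nhds (\<phi> p). P (X a)"
proof -
  have at: "smooth_atlas \<A>" and im: "immersion \<A> x"
    and sh: "\<And>U \<phi> p. (U, \<phi>) \<in> \<A> \<Longrightarrow> p \<in> U \<Longrightarrow>
        orth_normal_part (tangent_space (x \<circ> inv_into U \<phi>) (\<phi> p)) (x p)
          = - mean_curvature_vector (x \<circ> inv_into U \<phi>) (\<phi> p)"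
    using assms by (auto simp: self_shrinker_def)
  obtain U \<phi> where U: "(U, \<phi>) \<in> \<A>" "p \<in> U"
    using at unfolding smooth_atlas_def by blast
  have oU: "open U" and oV: "open (\<phi> ` U)" and hom: "homeomorphism U (\<phi> ` U) \<phi> (inv_into U \<phi>)"
    using at U(1) unfolding smooth_atlas_def by auto
  define X where "X = x \<circ> inv_into U \<phi>"
  have inv: "inv_into U \<phi> (\<phi> q) = q" if "q \<in> U" for q
    using hom that by (simp add: homeomorphism_apply1)
  have X: "X (\<phi> q) = x q" if "q \<in> U" for q
    using inv[OF that] by (simp add: X_def)
  have "isCont (inv_into U \<phi>) (\<phi> p)"
    using homeomorphism_cont2[OF hom] oV U(2) by (simp add: continuous_on_eq_continuous_at)
  then have lim: "filterlim (inv_into U \<phi>) (nhds p) (nhds (\<phi> p))"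
    using tendsto_at_iff_tendsto_nhds[of "inv_into U \<phi>" "\<phi> p"] inv[OF U(2)] by (simp add: isCont_def)
  show ?thesis
  proof (rule that[of U \<phi> "\<phi> ` U" X])
    show "isCont \<phi> p"
      using homeomorphism_cont1[OF hom] oU U(2) by (simp add: continuous_on_eq_continuous_at)
    show "smooth_on (\<phi> ` U) X" "\<And>a. a \<in> \<phi> ` U \<Longrightarrow> inj (frechet_derivative X (at a))"
      using im U(1) by (auto simp: immersion_def X_def)
    show "X (\<phi> q) = x q" if "q \<in> U" for q by (rule X[OF that])
    show "X ` \<phi> ` U \<subseteq> range x" by (auto simp: X_def)
    show "open U" "p \<in> U" "open (\<phi> ` U)" by (fact oU U oV)+
    show "orth_normal_part (tangent_space X a) (X a) = - mean_curvature_vector X a" if "a \<in> \<phi> ` U" for a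
      using that sh[OF U(1)] X unfolding X_def by auto
    show "\<forall>\<^sub>F a in nhds (\<phi> p). P (X a)" if "\<forall>\<^sub>F q in nhds p. P (x q)" for P :: "'b \<Rightarrow> bool"
      using eventually_compose_filterlim[OF that lim] by (simp add: X_def)
  qed (rule refl)
qed

lemma self_shrinker_isCont:
  fixes \<A> :: "('s::{t2_space, second_countable_topology}, 'm::finite) chart set"
  assumes "self_shrinker \<A> x"
  shows "isCont x p"
proof -
  obtain U and V :: "(real ^ 'm) set" and \<phi> X where c: "open U" "p \<in> U" "isCont \<phi> p" "V = \<phi> ` U" "open V" "smooth_on V X"
      "\<And>q. q \<in> U \<Longrightarrow> X (\<phi> q) = x q"
    using self_shrinker_chart[OF assms, of p] by metis
  have "isCont (\<lambda>q. X (\<phi> q)) p"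
    by (rule isCont_o2[OF c(3)]) (use c in \<open>auto intro: smooth_on_isCont\<close>)
  moreover have "\<forall>\<^sub>F q in nhds p. X (\<phi> q) = x q"
    using eventually_nhds_in_open[OF c(1,2)] by (rule eventually_mono) (rule c(7))
  ultimately show ?thesis using isCont_cong[of "\<lambda>q. X (\<phi> q)" x p] by simp
qed

lemma self_shrinker_local_minimum:
  fixes \<A> :: "('s::{t2_space, second_countable_topology}, 'm::finite) chart set"
  assumes "self_shrinker \<A> x"
  obtains B where "orthonormal B" "card B = CARD('m)"
    "\<And>G g H. twice_diff_at G g H (x p) \<Longrightarrow> \<forall>\<^sub>F q in nhds p. G (x p) \<le> G (x q) \<Longrightarrow>
       (\<forall>e\<in>B. g (x p) \<bullet> e = 0) \<and> shrinker_op B (g (x p)) H (x p) \<ge> 0"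
proof (rule self_shrinker_chart[OF assms, of p])
  fix U and V :: "(real ^ 'm) set" and \<phi> X
  assume c: "p \<in> U" "V = \<phi> ` U" "open V" "smooth_on V X"
      "\<And>q. q \<in> U \<Longrightarrow> X (\<phi> q) = x q"
      "\<And>a. a \<in> V \<Longrightarrow> inj (frechet_derivative X (at a))"
      "\<And>a. a \<in> V \<Longrightarrow> orth_normal_part (tangent_space X a) (X a) = - mean_curvature_vector X a"
      "\<And>P. \<forall>\<^sub>F q in nhds p. P (x q) \<Longrightarrow> \<forall>\<^sub>F a in nhds (\<phi> p). P (X a)"
  have "\<phi> p \<in> V" using c(1,2) by simp
  then obtain B where B: "orthonormal B" "card B = CARD('m)"
    "\<And>G g H. twice_diff_at G g H (X (\<phi> p)) \<Longrightarrow> \<forall>\<^sub>F a in nhds (\<phi> p). G (X (\<phi> p)) \<le> G (X a) \<Longrightarrow>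
       (\<forall>e\<in>B. g (X (\<phi> p)) \<bullet> e = 0) \<and> shrinker_op B (g (X (\<phi> p))) H (X (\<phi> p)) \<ge> 0"
    using self_shrinker_minimum_principle[OF c(3,4) _ c(6,7)] by metis
  show thesis
  proof (rule that[OF B(1,2)])
    fix G g H
    assume "twice_diff_at G g H (x p)" "\<forall>\<^sub>F q in nhds p. G (x p) \<le> G (x q)"
    then show "(\<forall>e\<in>B. g (x p) \<bullet> e = 0) \<and> shrinker_op B (g (x p)) H (x p) \<ge> 0"
      using B(3)[of G g H] c(8)[of "\<lambda>z. G (x p) \<le> G z"] by (simp add: c(5)[OF c(1)])
  qed
qed

lemma shrinker_barrier_zero_set_open:
  fixes \<A> :: "('s::{t2_space, second_countable_topology}, 'm::finite) chart set"
  assumes sh: "self_shrinker \<A> x" and v: "shrinker_barrier CARD('m) (range x) v"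
  shows "open {p. v (x p) = 0}"
  unfolding open_subopen[of "{p. v (x p) = 0}"]
proof (intro ballI)
  fix p assume "p \<in> {p. v (x p) = 0}"
  then have vp: "v (x p) = 0" by simp
  show "\<exists>T. open T \<and> p \<in> T \<and> T \<subseteq> {p. v (x p) = 0}"
  proof (rule self_shrinker_chart[OF sh, of p])
    fix U and V :: "(real ^ 'm) set" and \<phi> X
    assume c: "open U" "p \<in> U" "isCont \<phi> p" "V = \<phi> ` U" "open V" "smooth_on V X"
        "\<And>q. q \<in> U \<Longrightarrow> X (\<phi> q) = x q" "X ` V \<subseteq> range x"
        "\<And>a. a \<in> V \<Longrightarrow> inj (frechet_derivative X (at a))"
        "\<And>a. a \<in> V \<Longrightarrow> orth_normal_part (tangent_space X a) (X a) = - mean_curvature_vector X a"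
    have "shrinker_barrier CARD('m) (X ` V) v"
      using v c(8) unfolding shrinker_barrier_def by blast
    then have "\<forall>\<^sub>F a in nhds (\<phi> p). v (X a) = 0"
      using shrinker_strong_minimum_principle[OF c(5,6) _ c(9,10), of "\<phi> p" v] c(2,4) vp c(7) by auto
    moreover have "filterlim \<phi> (nhds (\<phi> p)) (nhds p)"
      using c(3) tendsto_at_iff_tendsto_nhds[of \<phi> p] by (simp add: isCont_def)
    ultimately have "\<forall>\<^sub>F q in nhds p. v (X (\<phi> q)) = 0"
      by (rule eventually_compose_filterlim)
    moreover have "\<forall>\<^sub>F q in nhds p. q \<in> U" using c by (simp add: eventually_nhds_in_open)
    ultimately have "\<forall>\<^sub>F q in nhds p. v (x q) = 0"
      by eventually_elim (simp add: c(7))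
    then show ?thesis
      unfolding eventually_nhds by blast
  qed
qed

section \<open>Parabolicity\<close>

text \<open>Khas'minskii's test: \<open>|x|\<^sup>2\<close> is a proper function with \<open>(\<Delta> - \<langle>x, \<nabla>\<rangle>) |x|\<^sup>2 = 2m - 2|x|\<^sup>2\<close>, so
  minima of \<open>v + \<epsilon> |x|\<^sup>2\<close> stay in the ball of radius \<open>\<surd>m\<close> as \<open>\<epsilon>\<close> tends to 0.\<close>

lemma shrinker_barrier_vanishes:
  fixes \<A> :: "('s::{t2_space, second_countable_topology}, 'm::finite) chart set"
  assumes sh: "self_shrinker \<A> x" and v: "shrinker_barrier CARD('m) (range x) v"
    and proper: "proper_map euclidean euclidean x"
  shows "v (x p) = 0"
proof (rule ccontr)
  assume "v (x p) \<noteq> 0"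
  define S where "S = {p. v (x p) \<noteq> 0}"
  have xc: "isCont x q" for q using self_shrinker_isCont[OF sh] .
  have vc: "isCont (\<lambda>q. v (x q)) q" for q
    using isCont_o2[OF xc shrinker_barrier_cont[OF v]] by blast
  have closed: "closed S"
    using shrinker_barrier_zero_set_open[OF sh v] by (simp add: S_def closed_def Compl_eq)
  have "closed {p. v (x p) = 0}"
    using vc by (intro closed_Collect_eq continuous_at_imp_continuous_on) auto
  then have "open S" by (simp add: S_def open_closed Compl_eq)
  have pS: "p \<in> S" using \<open>v (x p) \<noteq> 0\<close> by (simp add: S_def)
  have vpos: "v (x q) > 0" if "q \<in> S" for q
  proof -
    have "v (x q) \<ge> 0" using v by (simp add: shrinker_barrier_def)
    then show ?thesis using that by (simp add: S_def)
  qed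
  have cpt: "compact (S \<inter> {q. x q \<bullet> x q \<le> R})" for R
  proof -
    have "{q. x q \<bullet> x q \<le> R} = x -` cball 0 (sqrt R)"
      by (auto simp: norm_eq_sqrt_inner)
    moreover have "compact (x -` cball 0 (sqrt R))"
      using compactin_proper_map_preimage[OF proper, of "cball 0 (sqrt R)"]
      by (simp add: vimage_def)
    ultimately show ?thesis using closed by (simp add: closed_Int_compact)
  qed
  \<comment> \<open>The operator of the sum is nonnegative at \<open>a\<close> and that of
    \<open>v\<close> negative, so 2m - 2|x|^2 is positive. The bound is independent of
    \<open>\<epsilon>\<close>.\<close>
  have op: "x a \<bullet> x a < CARD('m)"
    if a: "a \<in> S" "\<And>b. b \<in> S \<Longrightarrow> v (x a) + \<epsilon> * (x a \<bullet> x a) \<le> v (x b) + \<epsilon> * (x b \<bullet> x b)"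
      and \<epsilon>: "\<epsilon> > 0" for a \<epsilon>
  proof -
    obtain B where B: "orthonormal B" "card B = CARD('m)"
      "\<And>G g H. twice_diff_at G g H (x a) \<Longrightarrow> \<forall>\<^sub>F q in nhds a. G (x a) \<le> G (x q) \<Longrightarrow>
       (\<forall>e\<in>B. g (x a) \<bullet> e = 0) \<and> shrinker_op B (g (x a)) H (x a) \<ge> 0"
      using self_shrinker_local_minimum[OF sh] by metis
    obtain gv Hv where gv: "twice_diff_at v gv Hv (x a)" "shrinker_op B (gv (x a)) Hv (x a) < 0"
      using v vpos[OF a(1)] B unfolding shrinker_barrier_def by blast
    have td: "twice_diff_at (\<lambda>y. y \<bullet> y) (\<lambda>y. 2 *\<^sub>R y) (\<lambda>h. 2 *\<^sub>R h) (x a)"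
      using twice_diff_at_dist_square[of 0 "x a"] by simp
    have "\<forall>\<^sub>F b in nhds a. v (x a) + \<epsilon> * (x a \<bullet> x a) \<le> v (x b) + \<epsilon> * (x b \<bullet> x b)"
      using eventually_nhds_in_open[OF \<open>open S\<close> a(1)] by (rule eventually_mono) (rule a(2))
    from B(3)[OF twice_diff_at_linear_combination[OF gv(1) td, of \<epsilon>] this]
    have "0 \<le> shrinker_op B (gv (x a)) Hv (x a) + \<epsilon> * shrinker_op B (2 *\<^sub>R x a) (\<lambda>h. 2 *\<^sub>R h) (x a)"
      unfolding shrinker_op_linear_combination by blast
    also have "shrinker_op B (2 *\<^sub>R x a) (\<lambda>h. 2 *\<^sub>R h) (x a) = 2 * CARD('m) - 2 * (x a \<bullet> x a)"
      using shrinker_op_dist_square[OF B(1), of "x a" 0] B(2) by simp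
    finally have "0 < \<epsilon> * (2 * CARD('m) - 2 * (x a \<bullet> x a))" using gv(2) by linarith
    then show ?thesis using \<epsilon> by (simp add: zero_less_mult_iff)
  qed
  have minimum: "\<exists>a\<in>S. x a \<bullet> x a < CARD('m) \<and> (\<forall>b\<in>S. v (x a) \<le> v (x b) + \<epsilon> * (x b \<bullet> x b))"
    if \<epsilon>: "\<epsilon> > 0" for \<epsilon>
  proof -
    define f where "f = (\<lambda>q. v (x q) + \<epsilon> * (x q \<bullet> x q))"
    \<comment> \<open>Off \<open>T\<close> the quadratic term alone exceeds \<open>f p\<close>, so a
      minimum over this compact set is one over all of \<open>S\<close>.\<close>
    define T where "T = S \<inter> {q. x q \<bullet> x q \<le> f p / \<epsilon>}"
    have "v (x p) > 0" using vpos pS by simp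
    then have "p \<in> T" using \<epsilon> pS by (simp add: T_def f_def pos_le_divide_eq mult.commute)
    have fc: "continuous_on T f"
      unfolding f_def by (intro continuous_at_imp_continuous_on ballI continuous_intros vc xc)
    obtain a where a: "a \<in> T" "\<And>b. b \<in> T \<Longrightarrow> f a \<le> f b"
      using continuous_attains_inf[OF cpt[of "f p / \<epsilon>", folded T_def] _ fc] \<open>p \<in> T\<close> by blast
    have all: "f a \<le> f b" if "b \<in> S" for b
    proof (cases "b \<in> T")
      case False
      then have "f p < \<epsilon> * (x b \<bullet> x b)"
        using that \<epsilon> by (simp add: T_def not_le pos_divide_less_eq mult.commute)
      then show ?thesis using a(2)[OF \<open>p \<in> T\<close>] vpos[OF that] by (simp add: f_def)
    qed (rule a(2))
    have "x a \<bullet> x a < CARD('m)"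
      using op[of a \<epsilon>] a(1) all \<epsilon> by (simp add: T_def f_def)
    moreover have "v (x a) \<le> f a" using \<epsilon> by (simp add: f_def)
    then have "\<forall>b\<in>S. v (x a) \<le> f b" using all order_trans by blast
    moreover have "a \<in> S" using a(1) by (simp add: T_def)
    ultimately show ?thesis unfolding f_def by blast
  qed
  define C where "C = S \<inter> {q. x q \<bullet> x q \<le> CARD('m)}"
  have "C \<noteq> {}" using minimum[of 1] by (auto simp: C_def intro: less_imp_le)
  moreover have "continuous_on C (\<lambda>q. v (x q))"
    by (intro continuous_at_imp_continuous_on ballI vc)
  ultimately obtain a where a: "a \<in> C" "\<And>b. b \<in> C \<Longrightarrow> v (x a) \<le> v (x b)"
    using continuous_attains_inf[OF cpt[of "CARD('m)", folded C_def]] by blast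
  have amin: "v (x a) \<le> v (x b)" if "b \<in> S" for b
  proof (rule field_le_epsilon)
    fix e :: real assume e: "e > 0"
    \<comment> \<open>For fixed \<open>b\<close> this keeps the penalty at \<open>b\<close> below
      \<open>e\<close>, while the penalized minimizer stays in the fixed compact set
      \<open>C\<close>.\<close>
    define \<epsilon> where "\<epsilon> = e / (1 + x b \<bullet> x b)"
    have bb: "1 + x b \<bullet> x b > 0" by (simp add: add_pos_nonneg)
    have \<epsilon>: "\<epsilon> > 0" using e bb by (simp add: \<epsilon>_def)
    obtain a' where a': "a' \<in> S" "x a' \<bullet> x a' < CARD('m)" "\<And>b. b \<in> S \<Longrightarrow> v (x a') \<le> v (x b) + \<epsilon> * (x b \<bullet> x b)"
      using minimum[OF \<epsilon>] by blast
    then have "a' \<in> C" by (simp add: C_def)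
    moreover have "v (x a') \<le> v (x b) + \<epsilon> * (x b \<bullet> x b)" using a'(3) that .
    moreover have "\<epsilon> * (x b \<bullet> x b) \<le> e"
      using e bb by (simp add: \<epsilon>_def pos_divide_le_eq)
    ultimately show "v (x a) \<le> v (x b) + e" using a(2)[of a'] by linarith
  qed
  have aS: "a \<in> S" using a(1) by (simp add: C_def)
  obtain B where B: "orthonormal B" "card B = CARD('m)"
    "\<And>G g H. twice_diff_at G g H (x a) \<Longrightarrow> \<forall>\<^sub>F q in nhds a. G (x a) \<le> G (x q) \<Longrightarrow>
     (\<forall>e\<in>B. g (x a) \<bullet> e = 0) \<and> shrinker_op B (g (x a)) H (x a) \<ge> 0"
    using self_shrinker_local_minimum[OF sh] by metis
  obtain gv Hv where gv: "twice_diff_at v gv Hv (x a)" "shrinker_op B (gv (x a)) Hv (x a) < 0"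
    using v vpos[OF aS] B unfolding shrinker_barrier_def by blast
  have "\<forall>\<^sub>F b in nhds a. v (x a) \<le> v (x b)"
    using eventually_nhds_in_open[OF \<open>open S\<close> aS] by (rule eventually_mono) (rule amin)
  then show False using B(3)[OF gv(1)] gv(2) by fastforce
qed

section \<open>Comparison with the cylinder\<close>

text \<open>The tangential trace is k + 1 - |n|^2, at least k because |n| \<le> 1; so the operator
  of the barrier is at most -2(k - |y|^2).\<close>

lemma cylinder_inside_barrier:
  assumes "CARD('p::finite) = k + 1" "CARD('q::finite) + k = m"
  shows "shrinker_barrier m {(y :: real ^ 'p, w :: real ^ 'q). norm y \<le> sqrt (real k)}
           (\<lambda>z. real k - fst z \<bullet> fst z)"
  unfolding shrinker_barrier_def
proof (intro ballI conjI)
  fix z :: "(real ^ 'p) \<times> (real ^ 'q)"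
  assume "z \<in> {(y, w). norm y \<le> sqrt (real k)}"
  then have z: "fst z \<bullet> fst z \<le> k"
    by (auto simp: norm_eq_sqrt_inner)
  then show "real k - fst z \<bullet> fst z \<ge> 0" by simp
  have 1: "((\<lambda>t. real k - t) has_real_derivative - 1) (at t)" for t
    by (auto intro!: derivative_eq_intros)
  have 2: "((\<lambda>t. - 1) has_real_derivative 0) (at t)" for t :: real
    by simp
  note td = twice_diff_at_compose[OF twice_diff_at_fst_square[of z] 1 2 open_UNIV UNIV_I]
  show "\<exists>g H. twice_diff_at (\<lambda>z. real k - fst z \<bullet> fst z) g H z \<and>
        (\<forall>B. orthonormal B \<longrightarrow> card B = m \<longrightarrow>
           shrinker_op B (g z) H z \<le> 0 \<and> (real k - fst z \<bullet> fst z > 0 \<longrightarrow> shrinker_op B (g z) H z < 0))"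
  proof (intro exI conjI, rule td, intro allI impI, rule conjI)
    fix B :: "((real ^ 'p) \<times> (real ^ 'q)) set"
    assume B: "orthonormal B" "card B = m"
    have "card B + 1 = CARD('p) + CARD('q)" using assms B(2) by simp
    then obtain n :: "real ^ 'p" where n: "norm n \<le> 1" "(\<Sum>e\<in>B. fst e \<bullet> fst e) = CARD('p) - n \<bullet> n"
      using sum_fst_square_orthonormal_hyperplane[OF B(1)] by metis
    have "n \<bullet> n \<le> 1" using n(1) by (simp add: norm_eq_sqrt_inner)
    then have "(\<Sum>e\<in>B. fst e \<bullet> fst e) \<ge> k" using n(2) assms(1) by simp
    moreover have "shrinker_op B (2 *\<^sub>R fst z, 0) (\<lambda>h. (2 *\<^sub>R fst h, 0)) z
        = 2 * (\<Sum>e\<in>B. fst e \<bullet> fst e) - 2 * (fst z \<bullet> fst z)"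
      by (simp add: shrinker_op_def inner_prod_def sum_distrib_left)
    ultimately have le: "shrinker_op B (- 1 *\<^sub>R (2 *\<^sub>R fst z, 0))
        (\<lambda>h. - 1 *\<^sub>R (2 *\<^sub>R fst h, 0) + (0 * ((2 *\<^sub>R fst z, 0) \<bullet> h)) *\<^sub>R (2 *\<^sub>R fst z, 0)) z
      \<le> - 2 * (real k - fst z \<bullet> fst z)"
      unfolding shrinker_op_compose by simp
    then show "shrinker_op B (- 1 *\<^sub>R (2 *\<^sub>R fst z, 0))
        (\<lambda>h. - 1 *\<^sub>R (2 *\<^sub>R fst h, 0) + (0 * ((2 *\<^sub>R fst z, 0) \<bullet> h)) *\<^sub>R (2 *\<^sub>R fst z, 0)) z \<le> 0"
      by (rule order_trans) (use z in simp)
    show "real k - fst z \<bullet> fst z > 0 \<longrightarrow> shrinker_op B (- 1 *\<^sub>R (2 *\<^sub>R fst z, 0))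
        (\<lambda>h. - 1 *\<^sub>R (2 *\<^sub>R fst h, 0) + (0 * ((2 *\<^sub>R fst z, 0) \<bullet> h)) *\<^sub>R (2 *\<^sub>R fst z, 0)) z < 0"
      by (intro impI le_less_trans[OF le]) simp
  qed
qed

text \<open>The excess 2(1 - |n|^2)/\<rho> in the trace is outweighed by the concavity term of
  \<open>ln\<close>, which by Cauchy-Schwarz is at most -4(1 - |n|^2)/\<rho>. What remains is at
  most 2(k - \<rho>)/\<rho>.\<close>

lemma cylinder_outside_barrier:
  assumes "CARD('p::finite) = k + 1" "CARD('q::finite) + k = m" "k \<ge> 1"
  shows "shrinker_barrier m {(y :: real ^ 'p, w :: real ^ 'q). norm y \<ge> sqrt (real k)}
           (\<lambda>z. ln (fst z \<bullet> fst z) - ln (real k))"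
  unfolding shrinker_barrier_def
proof (intro ballI conjI)
  fix z :: "(real ^ 'p) \<times> (real ^ 'q)"
  define \<rho> where "\<rho> = fst z \<bullet> fst z"
  assume "z \<in> {(y, w). norm y \<ge> sqrt (real k)}"
  then have z: "\<rho> \<ge> k"
    by (auto simp: norm_eq_sqrt_inner \<rho>_def)
  then have \<rho>: "\<rho> > 0" using assms(3) by linarith
  show "ln (fst z \<bullet> fst z) - ln (real k) \<ge> 0"
    using z \<rho> assms(3) ln_le_cancel_iff[of "real k" \<rho>] by (simp flip: \<rho>_def)
  have 1: "((\<lambda>t. ln t - ln (real k)) has_real_derivative inverse t) (at t)" if "t \<in> {0<..}" for t
    using that by (auto intro!: derivative_eq_intros simp: field_simps)
  have 2: "(inverse has_real_derivative - (inverse \<rho>)\<^sup>2) (at \<rho>)"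
    using DERIV_inverse[of \<rho>] \<rho> by (simp add: power2_eq_square power_inverse)
  have td: "twice_diff_at (\<lambda>y. ln (fst y \<bullet> fst y) - ln (real k)) (\<lambda>y. inverse (fst y \<bullet> fst y) *\<^sub>R (2 *\<^sub>R fst y, 0))
      (\<lambda>h. inverse \<rho> *\<^sub>R (2 *\<^sub>R fst h, 0) + (- (inverse \<rho>)\<^sup>2 * ((2 *\<^sub>R fst z, 0) \<bullet> h)) *\<^sub>R (2 *\<^sub>R fst z, 0)) z"
    using twice_diff_at_compose[OF twice_diff_at_fst_square[of z] 1 2[unfolded \<rho>_def] open_greaterThan] \<rho>
    unfolding \<rho>_def by blast
  show "\<exists>g H. twice_diff_at (\<lambda>z. ln (fst z \<bullet> fst z) - ln (real k)) g H z \<and>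
        (\<forall>B. orthonormal B \<longrightarrow> card B = m \<longrightarrow> shrinker_op B (g z) H z \<le> 0 \<and>
          (ln (fst z \<bullet> fst z) - ln (real k) > 0 \<longrightarrow> shrinker_op B (g z) H z < 0))"
  proof (intro exI conjI, rule td)
    show "\<forall>B. orthonormal B \<longrightarrow> card B = m \<longrightarrow> shrinker_op B (inverse (fst z \<bullet> fst z) *\<^sub>R (2 *\<^sub>R fst z, 0))
        (\<lambda>h. inverse \<rho> *\<^sub>R (2 *\<^sub>R fst h, 0) + (- (inverse \<rho>)\<^sup>2 * ((2 *\<^sub>R fst z, 0) \<bullet> h)) *\<^sub>R (2 *\<^sub>R fst z, 0)) z \<le> 0 \<and>
        (ln (fst z \<bullet> fst z) - ln (real k) > 0 \<longrightarrow> shrinker_op B (inverse (fst z \<bullet> fst z) *\<^sub>R (2 *\<^sub>R fst z, 0))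
        (\<lambda>h. inverse \<rho> *\<^sub>R (2 *\<^sub>R fst h, 0) + (- (inverse \<rho>)\<^sup>2 * ((2 *\<^sub>R fst z, 0) \<bullet> h)) *\<^sub>R (2 *\<^sub>R fst z, 0)) z < 0)"
      unfolding \<rho>_def[symmetric] shrinker_op_compose
    proof (intro allI impI)
      fix B :: "((real ^ 'p) \<times> (real ^ 'q)) set"
      assume B: "orthonormal B" "card B = m"
      have "card B + 1 = CARD('p) + CARD('q)" using assms B(2) by simp
      then obtain n :: "real ^ 'p" where n: "norm n \<le> 1" "(\<Sum>e\<in>B. fst e \<bullet> fst e) = CARD('p) - n \<bullet> n"
          "\<And>y. (\<Sum>e\<in>B. (y \<bullet> fst e)\<^sup>2) = y \<bullet> y - (y \<bullet> n)\<^sup>2"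
        using sum_fst_square_orthonormal_hyperplane[OF B(1)] by blast
      have nn: "n \<bullet> n \<le> 1" using n(1) by (simp add: norm_eq_sqrt_inner)
      have tr: "shrinker_op B (2 *\<^sub>R fst z, 0) (\<lambda>h. (2 *\<^sub>R fst h, 0)) z = 2 * (k + 1 - n \<bullet> n) - 2 * \<rho>"
        using n(2) assms(1)
        by (simp add: shrinker_op_def inner_prod_def \<rho>_def flip: sum_distrib_left)
      have "(\<Sum>e\<in>B. ((2 *\<^sub>R fst z, 0) \<bullet> e)\<^sup>2) = 4 * (\<Sum>e\<in>B. (fst z \<bullet> fst e)\<^sup>2)"
        by (simp add: inner_prod_def power_mult_distrib sum_distrib_left)
      also have "\<dots> = 4 * (\<rho> - (fst z \<bullet> n)\<^sup>2)" by (simp add: n(3) \<rho>_def)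
      also have "\<dots> \<ge> 4 * (\<rho> - \<rho> * (n \<bullet> n))"
        using Cauchy_Schwarz_ineq[of "fst z" n] by (simp add: \<rho>_def)
      finally have gr: "(\<Sum>e\<in>B. ((2 *\<^sub>R fst z, 0) \<bullet> e)\<^sup>2) \<ge> 4 * \<rho> * (1 - n \<bullet> n)"
        by (simp add: algebra_simps)
      let ?op = "inverse \<rho> * shrinker_op B (2 *\<^sub>R fst z, 0) (\<lambda>h. (2 *\<^sub>R fst h, 0)) z
          + - (inverse \<rho>)\<^sup>2 * (\<Sum>e\<in>B. ((2 *\<^sub>R fst z, 0) \<bullet> e)\<^sup>2)"
      have "?op \<le> inverse \<rho> * (2 * (k + 1 - n \<bullet> n) - 2 * \<rho>) - (inverse \<rho>)\<^sup>2 * (4 * \<rho> * (1 - n \<bullet> n))"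
        using mult_left_mono[OF gr, of "(inverse \<rho>)\<^sup>2"] by (simp add: tr)
      also have "\<dots> = inverse \<rho> * (2 * (k - \<rho>) - 2 * (1 - n \<bullet> n))"
        using \<rho> by (simp add: field_simps power2_eq_square)
      also have "\<dots> \<le> inverse \<rho> * (2 * (k - \<rho>))"
        using \<rho> nn by (intro mult_left_mono) auto
      finally have le: "?op \<le> inverse \<rho> * (2 * (k - \<rho>))" .
      have "inverse \<rho> * (2 * (k - \<rho>)) \<le> 0"
        using \<rho> z by (simp add: mult_nonneg_nonpos)
      moreover have "inverse \<rho> * (2 * (k - \<rho>)) < 0" if "ln \<rho> - ln k > 0"
      proof -
        have "\<rho> \<noteq> k" using that by auto
        then show ?thesis using \<rho> z by (simp add: mult_pos_neg)
      qed
      ultimately show "?op \<le> 0 \<and> (ln \<rho> - ln (real k) > 0 \<longrightarrow> ?op < 0)"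
        using le by linarith
    qed
  qed
qed

text \<open>A nearest point \<open>x p\<close> of the shrinker to \<open>c\<close> satisfies \<open>x p - c \<bottom> T\<^sub>p\<close>, and on the cylinder the
  normal line at \<open>x p\<close> meets the cylinder only in \<open>x p\<close> and its antipode.\<close>

lemma cylinder_nearby_point_in_range:
  fixes \<A> :: "('s::{t2_space, second_countable_topology}, 'm::finite) chart set"
    and x :: "'s \<Rightarrow> (real ^ 'p::finite) \<times> (real ^ 'q::finite)"
  assumes sh: "self_shrinker \<A> x" and closed: "closed (range x)" and r: "r > 0"
    and cyl: "\<And>p. norm (fst (x p)) = r"
    and c: "norm (fst c) = r" "dist c (x p0) < 2 * r"
  shows "c \<in> range x"
proof -
  obtain z where z: "z \<in> range x" "\<And>y. y \<in> range x \<Longrightarrow> dist c z \<le> dist c y"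
    using distance_attains_inf[OF closed, of c] by blast
  then obtain p where p: "z = x p" by blast
  obtain B where B: "orthonormal B" "card B = CARD('m)"
    "\<And>G g H. twice_diff_at G g H (x p) \<Longrightarrow> \<forall>\<^sub>F q in nhds p. G (x p) \<le> G (x q) \<Longrightarrow>
       (\<forall>e\<in>B. g (x p) \<bullet> e = 0) \<and> shrinker_op B (g (x p)) H (x p) \<ge> 0"
    using self_shrinker_local_minimum[OF sh] by metis
  have "(x p - c) \<bullet> (x p - c) \<le> (x q - c) \<bullet> (x q - c)" for q
    using z(2)[of "x q"] by (simp add: p dist_norm norm_minus_commute[of c] flip: norm_le)
  then have d0: "(x p - c) \<bullet> e = 0" if "e \<in> B" for e
    using B(3)[OF twice_diff_at_dist_square[of c "x p"]] that by simp
  \<comment> \<open>As |y|^2 is constant on the image, every point is a minimum of it, so the radial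
    vector is normal.\<close>
  have "fst (x q) \<bullet> fst (x q) = r\<^sup>2" for q
    using cyl[of q] by (simp add: power2_norm_eq_inner[symmetric])
  then have y0: "(fst (x p), 0) \<bullet> e = 0" if "e \<in> B" for e
    using B(3)[OF twice_diff_at_fst_square[of "x p"]] that by (simp add: inner_prod_def)
  have "card B + 1 = DIM((real ^ 'p) \<times> (real ^ 'q))"
    using sh B(2) by (simp add: self_shrinker_def)
  then obtain N where N: "norm N = 1" "\<And>e. e \<in> B \<Longrightarrow> e \<bullet> N = 0"
    "\<And>y z. y \<bullet> z = (\<Sum>e\<in>B. (y \<bullet> e) * (z \<bullet> e)) + (y \<bullet> N) * (z \<bullet> N)"
    using orthonormal_hyperplane_normal[OF B(1)] by blast
  have par: "y = (y \<bullet> N) *\<^sub>R N" if "\<And>e. e \<in> B \<Longrightarrow> y \<bullet> e = 0" for y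
  proof (rule vector_eq_rdot[THEN iffD1], rule allI)
    fix z show "y \<bullet> z = (y \<bullet> N) *\<^sub>R N \<bullet> z"
      using N(3)[of y z] that by (simp add: inner_commute)
  qed
  define y where "y = fst (x p)"
  obtain t where t: "(y, 0) = t *\<^sub>R N" using par[of "(y, 0)"] y0 unfolding y_def by blast
  have "y \<noteq> 0" using cyl[of p] r by (auto simp: y_def)
  then have "t \<noteq> 0" using t by (auto simp: zero_prod_def)
  obtain s where s: "x p - c = s *\<^sub>R N" using par[of "x p - c"] d0 by blast
  define l where "l = s / t"
  have l: "x p - c = l *\<^sub>R (y, 0)"
    unfolding t s l_def using \<open>t \<noteq> 0\<close> by simp
  \<comment> \<open>Equal radii leave \<open>l = 0\<close>, which is the claim, or
    \<open>l = 2\<close>, the antipode at distance \<open>2 * r\<close>.\<close>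
  have "fst c = (1 - l) *\<^sub>R y"
    using arg_cong[OF l, of fst] by (simp add: y_def algebra_simps)
  then have "\<bar>1 - l\<bar> * r = r" using c(1) cyl[of p] by (simp add: y_def)
  then have "l = 0 \<or> l = 2" using r by auto
  moreover have "l \<noteq> 2"
  proof
    assume "l = 2"
    then have "dist c (x p) = 2 * r"
      using l cyl[of p] r by (simp add: dist_norm norm_minus_commute[of c] norm_Pair y_def real_sqrt_mult)
    then show False using c(2) z(2)[of "x p0"] p by simp
  qed
  ultimately show ?thesis using l by (metis eq_iff_diff_eq_0 rangeI scale_zero_left)
qed

theorem theorem1:
  fixes k m :: nat
    and \<A> :: "('s::{t2_space, second_countable_topology}, 'm::finite) chart set"
    and x :: "'s \<Rightarrow> (real ^ 'p::finite) \<times> (real ^ 'q::finite)"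
  assumes "1 \<le> k" and "k \<le> m - 1"
    and "CARD('m) = m" and "CARD('p) = k + 1" and "CARD('q) = m - k"
    and "self_shrinker \<A> x"
    and "geodesically_complete \<A> x"
    and "proper_map euclidean euclidean x"
    and "range x \<subseteq> {(y, w). norm y \<le> sqrt (real k)} \<or>
         range x \<subseteq> {(y, w). norm y \<ge> sqrt (real k)}"
  shows "range x = {(y, w). norm y = sqrt (real k)}"
proof -
  let ?C = "{(y :: real ^ 'p, w :: real ^ 'q). norm y = sqrt (real k)}"
  note sh = \<open>self_shrinker \<A> x\<close> and proper = \<open>proper_map euclidean euclidean x\<close>
  have m: "CARD('q) + k = CARD('m)" using assms(1-5) by simp
  have "fst (x p) \<bullet> fst (x p) = k" for p
    using assms(9)
  proof
    assume "range x \<subseteq> {(y, w). norm y \<le> sqrt (real k)}"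
    then have "shrinker_barrier CARD('m) (range x) (\<lambda>z. real k - fst z \<bullet> fst z)"
      by (rule shrinker_barrier_subset[OF cylinder_inside_barrier[OF assms(4) m]])
    from shrinker_barrier_vanishes[OF sh this proper, of p] show ?thesis by simp
  next
    assume out: "range x \<subseteq> {(y, w). norm y \<ge> sqrt (real k)}"
    then have "shrinker_barrier CARD('m) (range x) (\<lambda>z. ln (fst z \<bullet> fst z) - ln (real k))"
      by (rule shrinker_barrier_subset[OF cylinder_outside_barrier[OF assms(4) m assms(1)]])
    from shrinker_barrier_vanishes[OF sh this proper, of p]
    have "ln (fst (x p) \<bullet> fst (x p)) = ln (real k)" by simp
    moreover have "fst (x p) \<bullet> fst (x p) \<ge> k"
      using out by (auto simp: norm_eq_sqrt_inner case_prod_beta image_subset_iff)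
    moreover have "real k > 0" using assms(1) by simp
    ultimately show ?thesis by (metis less_le_trans ln_inj_iff)
  qed
  then have cyl: "norm (fst (x p)) = sqrt (real k)" for p
    by (simp add: norm_eq_sqrt_inner)
  have "closed_map euclidean euclidean x" using proper by (rule proper_imp_closed_map)
  then have closed: "closed (range x)" by (simp add: closed_map_def)
  have sqk: "sqrt (real k) > 0" using assms(1) by simp
  \<comment> \<open>Here \<open>1 \<le> k\<close> gives the sphere an ambient dimension of at least
    2; for k = 0 it would be two points.\<close>
  have "connected (sphere (0 :: real ^ 'p) (sqrt (real k)) \<times> (UNIV :: (real ^ 'q) set))"
    using assms(1,4) by (intro connected_Times connected_sphere connected_UNIV) simp
  moreover have "sphere (0 :: real ^ 'p) (sqrt (real k)) \<times> (UNIV :: (real ^ 'q) set) = ?C"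
    by auto
  ultimately have conn: "connected ?C" by simp
  have sub: "range x \<subseteq> ?C" using cyl by (simp add: image_subset_iff case_prod_beta)
  have "openin (top_of_set ?C) (range x)"
    unfolding openin_euclidean_subtopology_iff
  proof (intro conjI sub ballI)
    fix z assume "z \<in> range x"
    then obtain p where p: "z = x p" by blast
    have "c \<in> range x" if "c \<in> ?C" "dist c z < 2 * sqrt (real k)" for c
      using cylinder_nearby_point_in_range[OF sh closed sqk cyl, of c p] that p
      by (auto simp: case_prod_beta)
    then show "\<exists>e>0. \<forall>c\<in>?C. dist c z < e \<longrightarrow> c \<in> range x"
      using sqk by (intro exI[of _ "2 * sqrt (real k)"]) auto
  qed
  moreover have "closedin (top_of_set ?C) (range x)"
    using closed sub by (simp add: closed_subset)
  ultimately have "range x = {} \<or> range x = ?C"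
    using conn unfolding connected_clopen by blast
  then show ?thesis by blast
qed

end
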